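(* Let $m\in\{1,2,\dots\}$ and let $q:\mathbb{R}^n\to\mathbb{R}^n$. Assume $x_*$ is a fixed point of $q$ and $W:=\nabla q(x_* )$ is symmetric with $\|W\|<1$. In addition, assume $q(x)$ and $(q-I)^{-1}(x)$ can be locally approximated by their first-order expansion at $x=x_*$; that is, there exist constants $c_1,C_1>0$ such that for all $x$ with $\|x-x_*\|\le c_1$, $$\big\|q(x)-\big(x_*+W(x-x_* )\big)\big\|\le C_1\|x-x_*\|^2,$$ $$\big\|(q-I)^{-1}(x)-(W-I)^{-1}(x-x_* )\big\|\le C_1\|x-x_*\|^2.$$ Lastly, assume $q(x)$ and $(q-I)^{-1}(x)$ are Lipschitz continuous in a neighborhood of $x_*$; that is, for all $x_1,x_2$ such that $\|x_1-x_*\|,\|x_2-x_*\|\le c_1$, $$\|q(x_1)-q(x_2)\|\le C_1\|x_1-x_2\|,\qquad \|(q-I)^{-1}(x_1)-(q-I)^{-1}(x_2)\|\le C_1\|x_1-x_2\|.$$ Then there exist constants $c_0',C_0'>0$ such that when the bound $C_0$ in the modified AA(m) is chosen to be larger than $C_0'$ and the initialization $x^{(1)}$ is sufficiently close to $x_*$ in the sense that $\|x^{(1)}-x_*\|<c_0'$, the modified AA(m) converges with local $r$-linear convergence factor no larger than $\sqrt{w_0\|W\|}$, where $$w_0=\sup_{\delta\ge 0}\ \sin\Bigg[\sin^{-1}\Big(\frac{|\lambda_{\max}(W)-\lambda_{\min}(W)|\,\delta}{\sqrt{4+(2-\lambda_{\max}(W)-\lambda_{\min}(W))^2\delta^2}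}\Big)+\Big|\tan^{-1}(\delta)-\tan^{-1}\Big(\big(1-\tfrac{\lambda_{\max}(W)+\lambda_{\min}(W)}{2}\big)\delta\Big)\Big|\Bigg].$$
   Context: $\|\cdot\|$ is the Euclidean norm on vectors and the spectral (operator) norm on matrices; $\lambda_{\max}(W),\lambda_{\min}(W)$ denote the largest and smallest eigenvalues of $W$; $I$ is the identity, and $(q-I)^{-1}$ is the inverse of the map $x\mapsto q(x)-x$. Modified AA(m) (windowed Anderson acceleration of depth $m$ with bounded coefficients), with a fixed constant $C_0>0$, applied to $q$ from $x^{(0)}\in\mathbb{R}^n$: set $x^{(1)}=q(x^{(0)})$. For $k=1,2,\dots$, let $m_k=\min(m,k)$, let $(\alpha^{(k)}_j)_{j=k-m_k}^{k}$ be real numbers minimizing $\big\|\sum_{j=k-m_k}^{k}\alpha_j\,(q(x^{(j)})-x^{(j)})\big\|$ subject to $\sum_{j=k-m_k}^{k}\alpha_j=1$ and $|\alpha_j|\le C_0$ for all $j$, and set $x^{(k+1)}=\sum_{j=k-m_k}^{k}\alpha^{(k)}_j\,q(x^{(j)})$. For a sequence $\{x^{(k)}\}$ converging to $x_*$, its $r$-linear convergence factor is $\limsup_{k\to\infty}\|x_*-x^{(k)}\|^{1/k}$.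
   Formalization: The radius c_0' is allowed to depend on the chosen bound C_0 > C_0'; a radius uniform in C_0 is impossible, e.g. for q(x)=x/2+x^2, m=2, x_*=0, where for large C_0 a non-unique minimizer can give x^(3)=1/2, another fixed point. *)

theory Defs
  imports "HOL-Analysis.Analysis"
begin

definition AA_window :: "nat \<Rightarrow> nat \<Rightarrow> nat set" where
  "AA_window m k = {k - min m k..k}"

definition AA_feasible :: "nat \<Rightarrow> real \<Rightarrow> nat \<Rightarrow> (nat \<Rightarrow> real) \<Rightarrow> bool" where
  "AA_feasible m C0 k \<alpha> \<longleftrightarrow>
     (\<Sum>j\<in>AA_window m k. \<alpha> j) = 1 \<and> (\<forall>j\<in>AA_window m k. \<bar>\<alpha> j\<bar> \<le> C0)"

text \<open>
  The minimizing coefficients need not be unique, so an iteration is a sequence in which every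
  step uses some minimizer; values of \<open>\<alpha>\<close> outside the window are irrelevant.
\<close>

definition modified_AA ::
  "nat \<Rightarrow> real \<Rightarrow> ('a::real_normed_vector \<Rightarrow> 'a) \<Rightarrow> (nat \<Rightarrow> 'a) \<Rightarrow> bool" where
  "modified_AA m C0 q x \<longleftrightarrow>
     x 1 = q (x 0) \<and>
     (\<forall>k\<ge>1. \<exists>\<alpha>.
        is_arg_min (\<lambda>\<alpha>. norm (\<Sum>j\<in>AA_window m k. \<alpha> j *\<^sub>R (q (x j) - x j)))
          (AA_feasible m C0 k) \<alpha> \<and>
        x (k + 1) = (\<Sum>j\<in>AA_window m k. \<alpha> j *\<^sub>R q (x j)))"

definition r_linear_factor :: "(nat \<Rightarrow> 'a::real_normed_vector) \<Rightarrow> 'a \<Rightarrow> ereal" where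
  "r_linear_factor x xs = limsup (\<lambda>k. ereal (root k (norm (xs - x k))))"

definition eigenvalues :: "real^'n^'n \<Rightarrow> real set" where
  "eigenvalues W = {l. \<exists>v. v \<noteq> 0 \<and> W *v v = l *\<^sub>R v}"

definition lambda_max :: "real^'n^'n \<Rightarrow> real" where
  "lambda_max W = Max (eigenvalues W)"

definition lambda_min :: "real^'n^'n \<Rightarrow> real" where
  "lambda_min W = Min (eigenvalues W)"

definition spectral_norm :: "real^'n^'n \<Rightarrow> real" where
  "spectral_norm W = onorm ((*v) W)"

definition w0 :: "real^'n^'n \<Rightarrow> real" where
  "w0 W = (SUP \<delta>\<in>{0..}.
     sin (arcsin (\<bar>lambda_max W - lambda_min W\<bar> * \<delta> /
                  sqrt (4 + (2 - lambda_max W - lambda_min W)\<^sup>2 * \<delta>\<^sup>2))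
          + \<bar>arctan \<delta> - arctan ((1 - (lambda_max W + lambda_min W) / 2) * \<delta>)\<bar>))"

text \<open>
  \<open>g\<close> is an inverse of \<open>f\<close> on the ball of radius \<open>c\<close> around \<open>y0\<close>. A global inverse of a bijection
  satisfies this for all \<open>y0\<close> and \<open>c\<close>.
\<close>

definition is_local_inverse ::
  "('a::metric_space \<Rightarrow> 'a) \<Rightarrow> ('a \<Rightarrow> 'a) \<Rightarrow> 'a \<Rightarrow> real \<Rightarrow> bool" where
  "is_local_inverse f g y0 c \<longleftrightarrow>
     (\<forall>y\<in>cball y0 c. f (g y) = y) \<and> (\<forall>\<^sub>F x in nhds (g y0). g (f x) = x)"

text \<open>
  Base point \<open>y0\<close> and value \<open>z0\<close> of the first-order expansion
  \<open>z0 + (W - I)\<^sup>-\<^sup>1 (y - y0)\<close> of \<open>(q - I)\<^sup>-\<^sup>1\<close>. Since \<open>q - I\<close> maps the fixed point \<open>xs\<close> to \<open>0\<close>, the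
  expansion corresponding to \<open>xs\<close> has base point \<open>0\<close> and value \<open>xs\<close>. The formula
  \<open>(W - I)\<^sup>-\<^sup>1 (y - xs)\<close> is the choice \<open>y0 = xs\<close>, \<open>z0 = 0\<close>; it agrees with the former exactly when
  \<open>xs = 0\<close>. Both are admitted.
\<close>

definition inverse_expansion_point :: "'a::zero \<Rightarrow> 'a \<Rightarrow> 'a \<Rightarrow> bool" where
  "inverse_expansion_point xs y0 z0 \<longleftrightarrow> (y0 = 0 \<and> z0 = xs) \<or> (y0 = xs \<and> z0 = 0)"

end

theory Submission
  imports Defs
begin

text \<open>
  Write \<open>f k\<close> for the residual \<open>q (x k) - x k\<close> and \<open>v k\<close> for the minimal mixed residual of step \<open>k\<close>.
  Up to an error quadratic in the window, \<open>f (k + 1) = W (v k)\<close>. As \<open>v k\<close> is the element of least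
  norm of a convex set containing \<open>f k\<close>, it satisfies \<open>v k \<bullet> (f k - v k) \<ge> 0\<close>. Plane geometry then
  bounds the distance from \<open>0\<close> to the line through \<open>f k\<close> and \<open>W (v k)\<close> by \<open>w0 * norm (f k)\<close>, and the
  closest point has coefficients bounded by \<open>1 + 1 / (1 - norm W)\<close>, so it competes in step
  \<open>k + 1\<close>. Hence \<open>norm (f (k + 2)) \<le> w0 * norm W * norm (f k)\<close> up to a quadratic error, which does
  not affect the r-linear factor.
\<close>

subsection \<open>Angles between residuals\<close>

lemma norm_diff_scaleR_squared:
  fixes x y :: "'a::real_inner"
  shows "(norm (x - c *\<^sub>R y))\<^sup>2 = (norm x)\<^sup>2 - 2 * c * (x \<bullet> y) + c\<^sup>2 * (norm y)\<^sup>2"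
  unfolding power2_norm_eq_inner
  by (simp add: inner_diff inner_commute algebra_simps power2_eq_square)

text \<open>Triangle inequality for angles that are bounded through their cosines. After
  normalization \<open>x\<close> and \<open>z\<close> are split along \<open>y\<close>, and
  Cauchy-Schwarz bounds the inner product of the orthogonal rests below by minus the product of
  their norms.\<close>

lemma cos_add_le_inner:
  fixes x y z :: "'a::real_inner"
  assumes "y \<noteq> 0" "0 \<le> \<alpha>" "0 \<le> \<beta>" "\<alpha> + \<beta> \<le> pi"
    and xy: "cos \<alpha> * norm x * norm y \<le> x \<bullet> y"
    and yz: "cos \<beta> * norm y * norm z \<le> y \<bullet> z"
  shows "cos (\<alpha> + \<beta>) * norm x * norm z \<le> x \<bullet> z"
proof (cases "x = 0 \<or> z = 0")
  case False
  define a b where "a = x \<bullet> y / (norm x * norm y)" and "b = y \<bullet> z / (norm y * norm z)"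
  have pos: "norm x > 0" "norm y > 0" "norm z > 0"
    using False assms(1) by auto
  have a: "\<bar>a\<bar> \<le> 1" and b: "\<bar>b\<bar> \<le> 1"
    using pos Cauchy_Schwarz_ineq2[of x y] Cauchy_Schwarz_ineq2[of y z]
    by (simp_all add: a_def b_def abs_mult divide_le_eq_1)
  have "cos \<alpha> \<le> a" "cos \<beta> \<le> b"
    using pos xy yz by (simp_all add: a_def b_def field_simps)
  have "arccos a \<le> \<alpha>"
    using arccos_le_mono[of "cos \<alpha>" a] a \<open>cos \<alpha> \<le> a\<close> assms(2-4) arccos_cos[of \<alpha>] by auto
  moreover have "arccos b \<le> \<beta>"
    using arccos_le_mono[of "cos \<beta>" b] b \<open>cos \<beta> \<le> b\<close> assms(2-4) arccos_cos[of \<beta>] by auto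
  moreover have "0 \<le> arccos a" "0 \<le> arccos b"
    using a b arccos_lbound by (auto simp: abs_le_iff)
  ultimately have "cos (\<alpha> + \<beta>) \<le> cos (arccos a + arccos b)"
    using assms(4) by (intro cos_monotone_0_pi_le) auto
  also have "\<dots> = a * b - sqrt (1 - a\<^sup>2) * sqrt (1 - b\<^sup>2)"
    using a b by (simp add: cos_add sin_arccos abs_le_iff cos_arccos_abs)
  finally have *: "cos (\<alpha> + \<beta>) \<le> a * b - sqrt (1 - a\<^sup>2) * sqrt (1 - b\<^sup>2)" .
  define X Y Z where "X = x /\<^sub>R norm x" and "Y = y /\<^sub>R norm y" and "Z = z /\<^sub>R norm z"
  have n: "X \<bullet> X = 1" "Y \<bullet> Y = 1" "Z \<bullet> Z = 1"
    using pos by (simp_all add: X_def Y_def Z_def dot_square_norm power2_eq_square field_simps)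
  have ab: "X \<bullet> Y = a" "Y \<bullet> Z = b"
    by (simp_all add: X_def Y_def Z_def a_def b_def field_simps)
  have "(norm (X - a *\<^sub>R Y))\<^sup>2 = 1 - a\<^sup>2" "(norm (Z - b *\<^sub>R Y))\<^sup>2 = 1 - b\<^sup>2"
    unfolding norm_diff_scaleR_squared using n ab
    by (simp_all add: power2_norm_eq_inner inner_commute) (simp_all add: power2_eq_square)
  hence "norm (X - a *\<^sub>R Y) = sqrt (1 - a\<^sup>2)" "norm (Z - b *\<^sub>R Y) = sqrt (1 - b\<^sup>2)"
    by (metis norm_ge_zero real_sqrt_unique)+
  hence "- (sqrt (1 - a\<^sup>2) * sqrt (1 - b\<^sup>2)) \<le> (X - a *\<^sub>R Y) \<bullet> (Z - b *\<^sub>R Y)"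
    using Cauchy_Schwarz_ineq2[of "X - a *\<^sub>R Y" "Z - b *\<^sub>R Y"] by auto
  also have "\<dots> = X \<bullet> Z - a * b"
    using n ab by (simp add: inner_diff inner_commute algebra_simps)
  finally have "cos (\<alpha> + \<beta>) \<le> X \<bullet> Z"
    using * by simp
  moreover have "X \<bullet> Z = x \<bullet> z / (norm x * norm z)"
    by (simp add: X_def Z_def field_simps)
  ultimately show ?thesis
    using pos by (simp add: field_simps)
qed auto

text \<open>Seen from the origin, a ball of radius \<open>norm c * sin A\<close> around
  \<open>c\<close> lies within the angle \<open>A\<close> of \<open>c\<close>.\<close>

lemma cos_le_inner_perturbed:
  fixes c z :: "'a::real_inner"
  assumes "norm z \<le> norm c * sin A"
  shows "cos A * norm c * norm (c + z) \<le> c \<bullet> (c + z)"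
proof -
  define G where "G = c + z"
  have "(norm z)\<^sup>2 \<le> (norm c)\<^sup>2 * (sin A)\<^sup>2"
    using power_mono[OF assms, of 2] by (simp add: power_mult_distrib)
  moreover have "(norm z)\<^sup>2 = (norm G)\<^sup>2 - 2 * (c \<bullet> G) + (norm c)\<^sup>2"
    by (simp add: G_def power2_norm_eq_inner inner_add inner_commute algebra_simps)
  moreover have "(norm c)\<^sup>2 * (sin A)\<^sup>2 = (norm c)\<^sup>2 - (norm c * cos A)\<^sup>2"
    by (simp add: sin_squared_eq algebra_simps power_mult_distrib)
  ultimately have "2 * (c \<bullet> G) \<ge> (norm G)\<^sup>2 + (norm c * cos A)\<^sup>2"
    by simp
  moreover have "(norm G)\<^sup>2 + (norm c * cos A)\<^sup>2 \<ge> 2 * norm G * (norm c * cos A)"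
    by (rule sum_squares_bound)
  ultimately show ?thesis
    by (simp add: G_def mult_ac)
qed

text \<open>
  For \<open>s\<close> the midpoint and \<open>r\<close> half the length of the spectral interval, \<open>w0\<close> is the supremum of
  \<open>sin (aa_angle s r \<delta>)\<close>. Split a residual \<open>F\<close> into its component along the mixed residual \<open>v\<close> and
  the rest; \<open>\<delta>\<close> is the ratio of their norms. Rescale \<open>v\<close> to be this component. The difference of
  arctangents is the angle between \<open>F\<close> and \<open>F - s v\<close>, and the arcsine bounds the angle between
  \<open>F - s v\<close> and \<open>F - W v\<close>.
\<close>

definition aa_angle :: "real \<Rightarrow> real \<Rightarrow> real \<Rightarrow> real" where
  "aa_angle s r \<delta> = arcsin (r * \<delta> / sqrt (1 + (1 - s)\<^sup>2 * \<delta>\<^sup>2)) + \<bar>arctan \<delta> - arctan ((1 - s) * \<delta>)\<bar>"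

lemma arctan_diff_cos:
  "cos \<bar>arctan x - arctan y\<bar> = (1 + x * y) / (sqrt (1 + x\<^sup>2) * sqrt (1 + y\<^sup>2))"
  by (simp add: cos_diff cos_arctan sin_arctan add_divide_distrib)

text \<open>The bound \<open>aa_angle s r \<delta> < pi / 2\<close> before \<open>arcsin\<close> is
  applied. Cleared of denominators and squared, it compares coefficients of powers of \<delta>, by
  \<open>r\<^sup>2 \<le> p\<close> and \<open>r\<^sup>2 \<le> p\<^sup>2\<close>; the constant 1
  makes it strict.\<close>

lemma aa_angle_arg_bounds:
  fixes s r \<delta> :: real
  assumes "0 \<le> r" "r < 1" "r < 1 - s" "0 \<le> \<delta>"
  defines "p \<equiv> 1 - s"
  shows "r * \<delta> / sqrt (1 + p\<^sup>2 * \<delta>\<^sup>2) < cos \<bar>arctan \<delta> - arctan (p * \<delta>)\<bar>"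
proof -
  have p: "0 < p" "r < p" using assms by auto
  have "r\<^sup>2 \<le> p"
    using assms(1,2) p by (smt (verit) mult_left_le power2_eq_square)
  moreover have "r\<^sup>2 \<le> p\<^sup>2"
    using assms p by (simp add: power_mono)
  ultimately have "r\<^sup>2 * \<delta>\<^sup>2 + r\<^sup>2 * \<delta>^4 \<le> p * \<delta>\<^sup>2 + p\<^sup>2 * \<delta>^4"
    by (intro add_mono mult_right_mono) auto
  moreover have "0 \<le> p * \<delta>\<^sup>2" using p by simp
  ultimately have "r\<^sup>2 * \<delta>\<^sup>2 + r\<^sup>2 * \<delta>^4 < 1 + 2 * (p * \<delta>\<^sup>2) + p\<^sup>2 * \<delta>^4"
    by linarith
  moreover have "(r * \<delta> * sqrt (1 + \<delta>\<^sup>2))\<^sup>2 = r\<^sup>2 * \<delta>\<^sup>2 + r\<^sup>2 * \<delta>^4"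
    by (simp add: power_mult_distrib algebra_simps flip: power_add)
  moreover have "(1 + p * \<delta>\<^sup>2)\<^sup>2 = 1 + 2 * (p * \<delta>\<^sup>2) + p\<^sup>2 * \<delta>^4"
    by (simp add: power2_sum power_mult_distrib flip: power_mult)
  ultimately have "(r * \<delta> * sqrt (1 + \<delta>\<^sup>2))\<^sup>2 < (1 + p * \<delta>\<^sup>2)\<^sup>2" by linarith
  hence *: "r * \<delta> * sqrt (1 + \<delta>\<^sup>2) < 1 + p * \<delta>\<^sup>2"
    by (rule power_less_imp_less_base) (use p in simp)
  have "1 + p\<^sup>2 * \<delta>\<^sup>2 > 0" "1 + \<delta>\<^sup>2 > 0"
    by (auto intro: add_pos_nonneg)
  hence "r * \<delta> / sqrt (1 + p\<^sup>2 * \<delta>\<^sup>2)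
      < (1 + p * \<delta>\<^sup>2) / (sqrt (1 + \<delta>\<^sup>2) * sqrt (1 + p\<^sup>2 * \<delta>\<^sup>2))"
    using * by (simp add: field_simps)
  thus ?thesis
    unfolding arctan_diff_cos by (simp add: power_mult_distrib power2_eq_square mult_ac)
qed

text \<open>Follows from the preceding inequality by \<open>cos B = sin (pi/2 - B)\<close>. An angle
  below \<open>pi / 2\<close> has a nonnegative cosine, which the cone argument uses.\<close>

lemma aa_angle_bounds:
  fixes s r \<delta> :: real
  assumes "0 \<le> r" "r < 1" "r < 1 - s" "0 \<le> \<delta>"
  shows "0 \<le> arcsin (r * \<delta> / sqrt (1 + (1 - s)\<^sup>2 * \<delta>\<^sup>2))" "aa_angle s r \<delta> < pi / 2"
    "sin (arcsin (r * \<delta> / sqrt (1 + (1 - s)\<^sup>2 * \<delta>\<^sup>2))) = r * \<delta> / sqrt (1 + (1 - s)\<^sup>2 * \<delta>\<^sup>2)"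
proof -
  define y where "y = r * \<delta> / sqrt (1 + (1 - s)\<^sup>2 * \<delta>\<^sup>2)"
  define B where "B = \<bar>arctan \<delta> - arctan ((1 - s) * \<delta>)\<bar>"
  have yB: "y < cos B"
    using aa_angle_arg_bounds[OF assms] by (simp add: y_def B_def)
  have y0: "0 \<le> y" using assms by (simp add: y_def)
  have B: "0 \<le> B" "B < pi/2"
    using assms arctan_ubound[of \<delta>] arctan_ubound[of "(1 - s) * \<delta>"]
    by (auto simp: B_def abs_less_iff) (smt (verit) zero_le_arctan_iff mult_nonneg_nonneg)+
  have y1: "y \<le> 1" using yB cos_le_one[of B] by linarith
  have "arcsin y < arcsin (cos B)"
    using yB y0 by (intro arcsin_less_arcsin) auto
  also have "cos B = sin (pi/2 - B)" by (simp add: sin_diff)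
  also have "arcsin \<dots> = pi/2 - B"
    by (rule arcsin_sin) (use B in auto)
  finally show "aa_angle s r \<delta> < pi / 2"
    by (simp add: aa_angle_def y_def B_def)
  show "0 \<le> arcsin (r * \<delta> / sqrt (1 + (1 - s)\<^sup>2 * \<delta>\<^sup>2))"
    using y0 y1 arcsin_le_arcsin[of 0 y] by (simp flip: y_def)
  show "sin (arcsin (r * \<delta> / sqrt (1 + (1 - s)\<^sup>2 * \<delta>\<^sup>2))) = r * \<delta> / sqrt (1 + (1 - s)\<^sup>2 * \<delta>\<^sup>2)"
    using y0 y1 by (simp flip: y_def)
qed

text \<open>Serves the case of \<open>F\<close> parallel to \<open>v\<close>: the ratio \<delta> is
  then infinite, and the limit bounds \<open>r / (1 - s)\<close> by the supremum.\<close>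

lemma sin_aa_angle_at_top:
  fixes s r :: real
  assumes "0 \<le> r" "r < 1 - s"
  shows "((\<lambda>\<delta>. sin (aa_angle s r \<delta>)) \<longlongrightarrow> r / (1 - s)) at_top"
proof -
  define p where "p = 1 - s"
  have p: "p > 0" "r < p" using assms by (auto simp: p_def)
  have inv: "((\<lambda>\<delta>::real. inverse \<delta>) \<longlongrightarrow> 0) at_top"
    by (rule tendsto_inverse_0_at_top) (rule filterlim_ident)
  have "((\<lambda>\<delta>::real. r / sqrt ((inverse \<delta>)\<^sup>2 + p\<^sup>2)) \<longlongrightarrow> r / sqrt (0\<^sup>2 + p\<^sup>2)) at_top"
    using p by (intro tendsto_intros inv) auto
  moreover have "\<forall>\<^sub>F \<delta> in at_top. r / sqrt ((inverse \<delta>)\<^sup>2 + p\<^sup>2) = r * \<delta> / sqrt (1 + p\<^sup>2 * \<delta>\<^sup>2)"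
    using eventually_gt_at_top[of 0]
  proof eventually_elim
    case (elim \<delta>)
    have "sqrt (1 + p\<^sup>2 * \<delta>\<^sup>2) = sqrt (((inverse \<delta>)\<^sup>2 + p\<^sup>2) * \<delta>\<^sup>2)"
      using elim by (simp add: algebra_simps power_inverse)
    also have "\<dots> = sqrt ((inverse \<delta>)\<^sup>2 + p\<^sup>2) * \<delta>"
      using elim by (simp add: real_sqrt_mult)
    finally show ?case using elim by simp
  qed
  ultimately have 1: "((\<lambda>\<delta>::real. r * \<delta> / sqrt (1 + p\<^sup>2 * \<delta>\<^sup>2)) \<longlongrightarrow> r / p) at_top"
    using p by (auto intro: Lim_transform_eventually)
  have rp: "0 \<le> r / p" "r / p < 1" using p assms by auto
  have "isCont arcsin (r / p)"
    using rp by (intro isCont_arcsin) auto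
  hence 2: "((\<lambda>\<delta>::real. arcsin (r * \<delta> / sqrt (1 + p\<^sup>2 * \<delta>\<^sup>2))) \<longlongrightarrow> arcsin (r / p)) at_top"
    using 1 by (rule isCont_tendsto_compose)
  have "filterlim (\<lambda>\<delta>. p * \<delta>) at_top at_top"
    using p by (intro filterlim_tendsto_pos_mult_at_top[OF tendsto_const] filterlim_ident)
  hence 3: "((\<lambda>\<delta>. arctan (p * \<delta>)) \<longlongrightarrow> pi / 2) at_top"
    by (rule filterlim_compose[OF tendsto_arctan_at_top])
  have "((\<lambda>\<delta>. sin (aa_angle s r \<delta>)) \<longlongrightarrow> sin (arcsin (r / p) + \<bar>pi/2 - pi/2\<bar>)) at_top"
    unfolding aa_angle_def p_def[symmetric]
    by (intro tendsto_intros 2 3 tendsto_arctan_at_top)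
  thus ?thesis using rp by (simp add: p_def)
qed

text \<open>
  The vectors with \<open>cos \<Theta> * norm F * norm G \<le> F \<bullet> G\<close> form a convex cone, so it suffices to treat
  the rescaled \<open>v\<close> that is the orthogonal projection of \<open>F\<close>; the actual \<open>v\<close> is \<open>t\<close> times it with
  \<open>t \<le> 1\<close>.
\<close>

lemma exists_step_residual_le:
  fixes F v :: "'a::real_inner" and W :: "'a \<Rightarrow> 'a"
  assumes W: "linear W"
    and sr: "0 \<le> r" "r < 1" "r < 1 - s" "\<And>y. norm (W y - s *\<^sub>R y) \<le> r * norm y"
    and \<rho>: "\<rho> < 1" "\<And>y. norm (W y) \<le> \<rho> * norm y" "0 \<le> \<rho>"
    and v: "0 \<le> v \<bullet> (F - v)"
    and \<omega>: "\<And>\<delta>. 0 \<le> \<delta> \<Longrightarrow> sin (aa_angle s r \<delta>) \<le> \<omega>"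
  shows "\<exists>\<tau>. \<bar>\<tau>\<bar> \<le> 1 / (1 - \<rho>) \<and> norm (F - \<tau> *\<^sub>R (F - W v)) \<le> \<omega> * norm F"
proof (cases "v = 0")
  case True
  have "0 \<le> \<omega>" using \<omega>[of 0] by (simp add: aa_angle_def)
  moreover have "W v = 0" using True W linear_0 by auto
  ultimately show ?thesis using \<rho> by (intro exI[of _ 1]) auto
next
  case False
  define p where "p = 1 - s"
  have p: "p > 0" "r < p" using sr by (auto simp: p_def)
  have rp\<omega>: "r / p \<le> \<omega>"
    unfolding p_def
    by (rule tendsto_upperbound[OF sin_aa_angle_at_top[OF sr(1,3)]])
       (auto intro: eventually_mono[OF eventually_ge_at_top[of 0]] \<omega>)
  have vF: "v \<bullet> v \<le> F \<bullet> v" "0 < v \<bullet> v"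
    using v False by (simp_all add: inner_diff inner_commute)
  \<comment> \<open>Chosen so that \<open>v'\<close> is the orthogonal projection of
    \<open>F\<close> onto the line of \<open>v\<close>; the hypothesis on \<open>v\<close> gives
    \<open>t \<le> 1\<close>.\<close>
  define t where "t = v \<bullet> v / (F \<bullet> v)"
  define v' where "v' = v /\<^sub>R t"
  have "0 < F \<bullet> v" using vF by linarith
  hence t: "0 < t" "t \<le> 1" using vF(1,2) by (simp_all only: t_def divide_pos_pos divide_le_eq_1_pos)
  have vt: "v = t *\<^sub>R v'" using t by (simp add: v'_def)
  define u where "u = F - v'"
  have "F \<bullet> v' = v' \<bullet> v'"
    using vF by (simp add: v'_def t_def field_simps)
  hence uv: "u \<bullet> v' = 0" "v' \<bullet> u = 0"
    by (simp_all add: u_def inner_diff inner_commute)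
  have v'0: "v' \<noteq> 0" using False t by (simp add: v'_def)
  have nF: "(norm F)\<^sup>2 = (norm v')\<^sup>2 + (norm u)\<^sup>2"
    using uv by (simp add: u_def power2_norm_eq_inner inner_diff inner_commute)
  hence "norm F \<ge> norm v'" by (metis norm_ge_zero power2_le_imp_le le_add_same_cancel1 zero_le_power2)
  hence F0: "norm F > 0" using v'0 by (smt (verit) zero_less_norm_iff)
  \<comment> \<open>\<open>c\<close> is \<open>F - s *\<^sub>R v'\<close>, the result if
    \<open>W\<close> acted as the scalar \<open>s\<close>; \<open>z\<close> corrects for the
    deviation.\<close>
  define c where "c = p *\<^sub>R v' + u"
  define z where "z = s *\<^sub>R v' - W v'"
  have cz: "c + z = F - W v'" by (simp add: c_def z_def u_def p_def algebra_simps)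
  have nz: "norm z \<le> r * norm v'" using sr(4)[of v'] by (simp add: z_def norm_minus_commute)
  have nc: "(norm c)\<^sup>2 = p\<^sup>2 * (norm v')\<^sup>2 + (norm u)\<^sup>2"
    unfolding power2_norm_eq_inner c_def using uv
    by (simp add: inner_add algebra_simps power2_eq_square)
  have Fc: "F \<bullet> c = p * (norm v')\<^sup>2 + (norm u)\<^sup>2"
  proof -
    have "F = v' + u" by (simp add: u_def)
    thus ?thesis using uv by (simp add: c_def power2_norm_eq_inner inner_add algebra_simps)
  qed
  have c0: "c \<noteq> 0" using nc p v'0 by (smt (verit) norm_zero power2_less_0 zero_less_norm_iff
     zero_less_power mult_pos_pos zero_power2)
  obtain A B where AB: "0 \<le> A" "0 \<le> B" "A + B < pi / 2" "sin (A + B) \<le> \<omega>"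
    "norm z \<le> norm c * sin A" "cos B * norm F * norm c \<le> F \<bullet> c"
  proof (cases "u = 0")
    case True
    \<comment> \<open>Infinite \<delta>: \<open>c\<close> is a positive multiple of
      \<open>F\<close>, so \<open>B = 0\<close>, and \<open>A\<close> is the limiting arcsine,
      controlled by \<open>rp\<omega>\<close>.\<close>
    hence cu: "c = p *\<^sub>R F" "F = v'" by (simp_all add: c_def u_def)
    have rp: "0 \<le> r / p" "r / p < 1" using p sr by auto
    have "arcsin (r / p) < pi / 2" using rp arcsin_lt_bounded[of "r/p"] by auto
    moreover have "0 \<le> arcsin (r / p)" using rp arcsin_le_arcsin[of 0 "r/p"] by simp
    ultimately show ?thesis
      using rp p nz rp\<omega> that[of "arcsin (r / p)" 0] cu by (auto simp: dot_square_norm power2_eq_square mult_ac)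
  next
    case False
    define \<delta> where "\<delta> = norm v' / norm u"
    have \<delta>: "0 \<le> \<delta>" "norm v' = \<delta> * norm u" using False by (auto simp: \<delta>_def)
    define A where "A = arcsin (r * \<delta> / sqrt (1 + p\<^sup>2 * \<delta>\<^sup>2))"
    define B where "B = \<bar>arctan \<delta> - arctan (p * \<delta>)\<bar>"
    note bd = aa_angle_bounds[OF sr(1-3) \<delta>(1), folded p_def, folded A_def]
    have AB: "A + B = aa_angle s r \<delta>" by (simp add: A_def B_def aa_angle_def p_def)
    have "(norm c)\<^sup>2 = (norm u * sqrt (1 + p\<^sup>2 * \<delta>\<^sup>2))\<^sup>2"
      by (simp add: nc \<delta> power_mult_distrib algebra_simps)
    hence c': "norm c = norm u * sqrt (1 + p\<^sup>2 * \<delta>\<^sup>2)"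
      by (rule power2_eq_imp_eq) auto
    have "(norm F)\<^sup>2 = (norm u * sqrt (1 + \<delta>\<^sup>2))\<^sup>2"
      by (simp add: nF \<delta> power_mult_distrib algebra_simps)
    hence F': "norm F = norm u * sqrt (1 + \<delta>\<^sup>2)"
      by (rule power2_eq_imp_eq) auto
    have sq: "sqrt (1 + p\<^sup>2 * \<delta>\<^sup>2) > 0" "sqrt (1 + \<delta>\<^sup>2) > 0" by (simp_all add: add_pos_nonneg)
    have "norm z \<le> norm c * sin A"
      using nz sq by (simp add: bd(3) c' \<delta> mult_ac)
    moreover have "cos B * norm F * norm c = F \<bullet> c"
    proof -
      have "cos B = (1 + \<delta> * (p * \<delta>)) / (sqrt (1 + \<delta>\<^sup>2) * sqrt (1 + p\<^sup>2 * \<delta>\<^sup>2))"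
        unfolding B_def arctan_diff_cos by (simp add: power_mult_distrib)
      hence "cos B * norm F * norm c = (1 + \<delta> * (p * \<delta>)) * (norm u)\<^sup>2"
        using sq by (simp add: F' c' power2_eq_square field_simps)
      also have "\<dots> = F \<bullet> c"
        by (simp add: Fc \<delta> power2_eq_square algebra_simps)
      finally show ?thesis .
    qed
    ultimately show ?thesis
      using that[of A B] bd(1,2) AB \<omega>[OF \<delta>(1)] by (auto simp: B_def)
  qed
  define \<Theta> where "\<Theta> = A + B"
  have \<Theta>: "0 \<le> \<Theta>" "\<Theta> < pi / 2" using AB by (auto simp: \<Theta>_def)
  have cos\<Theta>: "0 \<le> cos \<Theta>" using \<Theta> by (intro cos_ge_zero) auto
  have "cos (B + A) * norm F * norm (c + z) \<le> F \<bullet> (c + z)"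
    using AB by (intro cos_add_le_inner[OF c0] cos_le_inner_perturbed) auto
  hence cone: "cos \<Theta> * norm F * norm (F - W v') \<le> F \<bullet> (F - W v')"
    by (simp add: \<Theta>_def cz add.commute)
  define G where "G = F - W v"
  have G: "G = (1 - t) *\<^sub>R F + t *\<^sub>R (F - W v')"
    using W by (simp add: G_def vt linear_cmul algebra_simps)
  have "cos \<Theta> * norm F * norm G \<le> cos \<Theta> * norm F * ((1 - t) * norm F + t * norm (F - W v'))"
    using t cos\<Theta> norm_triangle_ineq[of "(1 - t) *\<^sub>R F" "t *\<^sub>R (F - W v')"]
    by (intro mult_left_mono) (auto simp: G)
  also have "\<dots> = (1 - t) * (cos \<Theta> * (norm F)\<^sup>2) + t * (cos \<Theta> * norm F * norm (F - W v'))"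
    by (simp add: algebra_simps power2_eq_square)
  also have "\<dots> \<le> (1 - t) * (F \<bullet> F) + t * (F \<bullet> (F - W v'))"
    using t cone by (intro add_mono mult_left_mono) (auto simp: power2_norm_eq_inner mult_left_le_one_le cos\<Theta>)
  also have "\<dots> = F \<bullet> G"
    by (simp add: G inner_add inner_diff algebra_simps)
  finally have coneG: "cos \<Theta> * norm F * norm G \<le> F \<bullet> G" .
  have "(norm v)\<^sup>2 \<le> norm F * norm v"
    using vF Cauchy_Schwarz_ineq2[of F v] by (simp add: power2_norm_eq_inner)
  hence "norm v \<le> norm F" using False by (simp add: power2_eq_square)
  hence "norm (W v) \<le> \<rho> * norm F" using \<rho>(2)[of v] \<rho>(3) by (meson mult_left_mono order_trans)
  hence nG: "(1 - \<rho>) * norm F \<le> norm G"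
    using norm_triangle_ineq2[of F "W v"] by (simp add: G_def algebra_simps)
  hence G0: "0 < norm G" using F0 \<rho>(1) by (smt (verit) mult_pos_pos)
  \<comment> \<open>The minimizer of \<open>norm (F - \<tau> *\<^sub>R G)\<close>, bounded because
    \<open>nG\<close> keeps \<open>G\<close> from being short. The minimum is \<open>norm F\<close>
    times the sine of the angle between \<open>F\<close> and \<open>G\<close>, which is at most
    \<Theta> by \<open>coneG\<close>.\<close>
  define \<tau> where "\<tau> = F \<bullet> G / (norm G)\<^sup>2"
  have "\<bar>\<tau>\<bar> \<le> norm F / norm G"
    using Cauchy_Schwarz_ineq2[of F G] G0 by (simp add: \<tau>_def field_simps power2_eq_square abs_mult)
  also have "\<dots> \<le> 1 / (1 - \<rho>)"
    using nG G0 \<rho>(1) by (simp add: field_simps)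
  finally have 1: "\<bar>\<tau>\<bar> \<le> 1 / (1 - \<rho>)" .
  have "(norm (F - \<tau> *\<^sub>R G))\<^sup>2 = (norm F)\<^sup>2 - 2 * \<tau> * (F \<bullet> G) + \<tau>\<^sup>2 * (norm G)\<^sup>2"
    by (rule norm_diff_scaleR_squared)
  also have "\<dots> = (norm F)\<^sup>2 - (F \<bullet> G)\<^sup>2 / (norm G)\<^sup>2"
    using G0 by (simp add: \<tau>_def power2_eq_square)
  also have "\<dots> \<le> (norm F)\<^sup>2 - (cos \<Theta> * norm F)\<^sup>2"
  proof -
    have "cos \<Theta> * norm F \<le> (F \<bullet> G) / norm G"
      using coneG G0 by (simp add: field_simps)
    thus ?thesis
      using power_mono[of "cos \<Theta> * norm F" "(F \<bullet> G) / norm G" 2] cos\<Theta> by (simp add: power_divide)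
  qed
  also have "\<dots> = (sin \<Theta> * norm F)\<^sup>2"
    by (simp add: power_mult_distrib sin_squared_eq algebra_simps)
  finally have "norm (F - \<tau> *\<^sub>R G) \<le> sin \<Theta> * norm F"
    by (rule power2_le_imp_le) (use \<Theta> in \<open>auto intro!: mult_nonneg_nonneg sin_ge_zero\<close>)
  also have "\<dots> \<le> \<omega> * norm F"
    using AB(4) by (intro mult_right_mono) (auto simp: \<Theta>_def)
  finally show ?thesis using 1 by (auto simp: G_def)
qed

subsection \<open>Spectra of symmetric matrices\<close>

text \<open>A unit vector \<open>x\<close> maximizing \<open>norm (T x)\<close> satisfies
  \<open>T (T x) = M\<^sup>2 *\<^sub>R x\<close>, since the squared norm of the difference is at
  most 0. Hence either \<open>x\<close> is an eigenvector for \<open>- M\<close>, or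
  \<open>T x + M *\<^sub>R x\<close> is one for \<open>M\<close>.\<close>

lemma selfadjoint_norm_eigenvalue:
  fixes T :: "'a::euclidean_space \<Rightarrow> 'a"
  assumes T: "linear T" and sym: "\<And>x y. T x \<bullet> y = x \<bullet> T y"
  obtains x \<mu> where "x \<noteq> 0" "T x = \<mu> *\<^sub>R x" "\<bar>\<mu>\<bar> = onorm T"
proof -
  have bl: "bounded_linear T" using T by (simp add: linear_conv_bounded_linear)
  obtain x where x: "x \<in> sphere 0 1" "\<And>y. y \<in> sphere 0 1 \<Longrightarrow> norm (T y) \<le> norm (T x)"
    using continuous_attains_sup[of "sphere 0 1" "\<lambda>y. norm (T y)"] bl
    by (auto simp: linear_continuous_on continuous_on_norm)
  define M where "M = norm (T x)"
  have nx: "norm x = 1" using x by simp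
  have le: "norm (T y) \<le> M * norm y" for y
  proof (cases "y = 0")
    case False
    thus ?thesis
      using x(2)[of "y /\<^sub>R norm y"] T by (simp add: linear_cmul M_def field_simps)
  qed (use T linear_0 in auto)
  have M: "onorm T = M"
  proof (rule antisym)
    show "onorm T \<le> M" by (rule onorm_le) (use le in simp)
    show "M \<le> onorm T" using onorm[OF bl, of x] nx by (simp add: M_def)
  qed
  have M0: "0 \<le> M" by (simp add: M_def)
  have "T (T x) \<bullet> x = M\<^sup>2" by (simp add: sym M_def power2_norm_eq_inner)
  hence "(norm (T (T x) - M\<^sup>2 *\<^sub>R x))\<^sup>2 = (norm (T (T x)))\<^sup>2 - (M\<^sup>2)\<^sup>2"
    unfolding norm_diff_scaleR_squared using nx by (simp add: power2_eq_square)
  also have "\<dots> \<le> 0"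
  proof -
    have "norm (T (T x)) \<le> M\<^sup>2" using le[of "T x"] by (simp add: M_def power2_eq_square)
    thus ?thesis using power_mono[of "norm (T (T x))" "M\<^sup>2" 2] by simp
  qed
  finally have TT: "T (T x) = M\<^sup>2 *\<^sub>R x" by simp
  show thesis
  proof (cases "T x + M *\<^sub>R x = 0")
    case True
    hence "T x = (- M) *\<^sub>R x" by (simp add: eq_neg_iff_add_eq_0)
    moreover have "x \<noteq> 0" using nx by auto
    ultimately show thesis using that M M0 by (metis abs_minus_cancel abs_of_nonneg)
  next
    case False
    moreover have "T (T x + M *\<^sub>R x) = M *\<^sub>R (T x + M *\<^sub>R x)"
      using T TT by (simp add: linear_add linear_cmul algebra_simps power2_eq_square)
    ultimately show thesis using that M M0 by (metis abs_of_nonneg)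
  qed
qed

lemma symmetric_matrix_inner:
  fixes W :: "real^'n^'n"
  assumes "transpose W = W"
  shows "(W *v x) \<bullet> y = x \<bullet> (W *v y)"
  by (metis assms dot_lmul_matrix transpose_matrix_vector)

text \<open>Eigenvectors of distinct eigenvalues are orthogonal, hence independent. Finiteness gives
  \<open>Max\<close> and \<open>Min\<close> of the spectrum their meaning.\<close>

lemma finite_eigenvalues:
  fixes W :: "real^'n^'n"
  assumes W: "transpose W = W"
  shows "finite (eigenvalues W)"
proof -
  define ev where "ev l = (SOME v. v \<noteq> 0 \<and> W *v v = l *\<^sub>R v)" for l
  have ev: "ev l \<noteq> 0" "W *v ev l = l *\<^sub>R ev l" if "l \<in> eigenvalues W" for l
  proof -
    have "\<exists>v. v \<noteq> 0 \<and> W *v v = l *\<^sub>R v" using that by (simp add: eigenvalues_def)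
    from someI_ex[OF this] show "ev l \<noteq> 0" "W *v ev l = l *\<^sub>R ev l" by (auto simp: ev_def)
  qed
  have orth: "ev l \<bullet> ev l' = 0" if "l \<in> eigenvalues W" "l' \<in> eigenvalues W" "l \<noteq> l'" for l l'
    using symmetric_matrix_inner[OF W, of "ev l" "ev l'"] that by (simp add: ev)
  have inj: "inj_on ev (eigenvalues W)"
    by (rule inj_onI) (metis ev(1) inner_eq_zero_iff orth)
  have "pairwise orthogonal (ev ` eigenvalues W)"
    by (auto simp: pairwise_def orthogonal_def intro: orth)
  hence "independent (ev ` eigenvalues W)"
    by (rule pairwise_orthogonal_independent) (use ev(1) in auto)
  hence "finite (ev ` eigenvalues W)" by (rule independent_imp_finite)
  thus ?thesis using inj finite_imageD by blast
qed

text \<open>Shifting \<open>W\<close> by the midpoint \<open>s\<close> of the spectrum yields a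
  selfadjoint \<open>T\<close> with an eigenvalue \<mu> whose modulus is the norm of
  \<open>T\<close>. As \<open>\<mu> + s\<close> is an eigenvalue of \<open>W\<close>, the spectrum
  is nonempty and the modulus is at most half its length.\<close>

lemma symmetric_spectrum:
  fixes W :: "real^'n^'n"
  assumes W: "transpose W = W"
  shows "lambda_max W \<in> eigenvalues W" "lambda_min W \<in> eigenvalues W" "lambda_min W \<le> lambda_max W"
    and "norm (W *v y - ((lambda_max W + lambda_min W) / 2) *\<^sub>R y)
      \<le> (lambda_max W - lambda_min W) / 2 * norm y"
proof -
  define s where "s = (lambda_max W + lambda_min W) / 2"
  define T where "T y = W *v y - s *\<^sub>R y" for y
  note fin = finite_eigenvalues[OF W]
  have bl: "bounded_linear T"
    unfolding T_def by (intro bounded_linear_sub matrix_vector_mul_bounded_linear bounded_linear_scaleR_right)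
  have "T x \<bullet> y = x \<bullet> T y" for x y
    by (simp add: T_def inner_diff symmetric_matrix_inner[OF W])
  then obtain x \<mu> where x: "x \<noteq> 0" "T x = \<mu> *\<^sub>R x" "\<bar>\<mu>\<bar> = onorm T"
    using selfadjoint_norm_eigenvalue bl bounded_linear.linear by metis
  have "W *v x = (\<mu> + s) *\<^sub>R x" using x(2) by (simp add: T_def algebra_simps)
  hence \<mu>: "\<mu> + s \<in> eigenvalues W" using x(1) by (auto simp: eigenvalues_def)
  show "lambda_max W \<in> eigenvalues W" "lambda_min W \<in> eigenvalues W"
    using fin \<mu> by (auto simp: lambda_max_def lambda_min_def intro!: Max_in Min_in)
  have mM: "\<mu> + s \<le> lambda_max W" "lambda_min W \<le> \<mu> + s"
    using fin \<mu> by (auto simp: lambda_max_def lambda_min_def)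
  thus "lambda_min W \<le> lambda_max W" by linarith
  have "onorm T \<le> (lambda_max W - lambda_min W) / 2"
    using mM x(3) by (auto simp: s_def abs_if field_simps split: if_splits)
  hence "norm (T y) \<le> (lambda_max W - lambda_min W) / 2 * norm y"
    using onorm[OF bl, of y] by (meson mult_right_mono norm_ge_zero order_trans)
  thus "norm (W *v y - ((lambda_max W + lambda_min W) / 2) *\<^sub>R y)
      \<le> (lambda_max W - lambda_min W) / 2 * norm y"
    by (simp add: T_def s_def)
qed

lemma eigenvalue_le_spectral_norm:
  assumes "l \<in> eigenvalues W"
  shows "\<bar>l\<bar> \<le> spectral_norm W"
proof -
  obtain v where "v \<noteq> 0" "W *v v = l *\<^sub>R v" using assms by (auto simp: eigenvalues_def)
  thus ?thesis
    using onorm[OF matrix_vector_mul_bounded_linear[of W], of v] by (simp add: spectral_norm_def)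
qed

subsection \<open>Scalar recursions with a quadratic remainder\<close>

text \<open>Strong induction. One factor of \<open>M\<^sup>2\<close> is bounded by \<epsilon>, the
  other by the induction hypothesis at the oldest index, which lags by \<open>m\<close>; the factor
  \<open>\<sigma> ^ m\<close> in the smallness condition pays for this lag.\<close>

lemma geometric_decay_of_recursion:
  fixes a :: "nat \<Rightarrow> real"
  assumes rec: "\<And>k M. \<lbrakk>N \<le> k; 0 \<le> M; \<And>j. k - m \<le> j \<Longrightarrow> j \<le> k + 1 \<Longrightarrow> a j \<le> M\<rbrakk>
      \<Longrightarrow> a (k + 2) \<le> \<kappa> * a k + C * M\<^sup>2"
    and small: "\<And>j. N - m \<le> j \<Longrightarrow> a j \<le> \<epsilon>"
    and "m \<le> N" "0 \<le> \<kappa>" "0 \<le> C" "0 \<le> \<epsilon>" "0 < \<sigma>" "\<sigma> \<le> 1" "C * \<epsilon> \<le> (\<sigma>\<^sup>2 - \<kappa>) * \<sigma> ^ m"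
  shows "\<exists>B>0. \<forall>k. a k \<le> B * \<sigma> ^ k"
proof -
  \<comment> \<open>Covers the indices up to \<open>N + 1\<close>, which the recursion does not
    reach; the summand 1 makes it positive.\<close>
  define B where "B = 1 + (\<Sum>j\<le>N+1. \<bar>a j\<bar> / \<sigma> ^ j)"
  have B: "B > 0" unfolding B_def using \<open>0 < \<sigma>\<close> by (intro add_pos_nonneg sum_nonneg) auto
  have "a k \<le> B * \<sigma> ^ k" for k
  proof (induction k rule: less_induct)
    case (less k)
    show ?case
    proof (cases "k \<le> N + 1")
      case True
      have "\<bar>a k\<bar> / \<sigma> ^ k \<le> (\<Sum>j\<le>N+1. \<bar>a j\<bar> / \<sigma> ^ j)"
        using True \<open>0 < \<sigma>\<close> by (intro member_le_sum) auto
      hence "\<bar>a k\<bar> / \<sigma> ^ k \<le> B" by (simp add: B_def)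
      hence "\<bar>a k\<bar> \<le> B * \<sigma> ^ k" using \<open>0 < \<sigma>\<close> by (simp add: field_simps)
      thus ?thesis by simp
    next
      case False
      define i where "i = k - 2"
      have i: "k = i + 2" "N \<le> i" using False by (auto simp: i_def)
      define M where "M = min \<epsilon> (B * \<sigma> ^ (i - m))"
      have M0: "0 \<le> M" using B \<open>0 < \<sigma>\<close> \<open>0 \<le> \<epsilon>\<close> by (simp add: M_def)
      have "a j \<le> M" if j: "i - m \<le> j" "j \<le> i + 1" for j
      proof -
        have "a j \<le> \<epsilon>" by (rule small) (use j i \<open>m \<le> N\<close> in linarith)
        moreover have "a j \<le> B * \<sigma> ^ j" using less.IH[of j] j i by simp
        moreover have "B * \<sigma> ^ j \<le> B * \<sigma> ^ (i - m)"
          using B j \<open>0 < \<sigma>\<close> \<open>\<sigma> \<le> 1\<close> by (intro mult_left_mono power_decreasing) auto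
        ultimately show ?thesis by (simp add: M_def)
      qed
      hence "a k \<le> \<kappa> * a i + C * M\<^sup>2"
        unfolding i(1) using i(2) M0 by (intro rec) auto
      also have "\<dots> \<le> \<kappa> * (B * \<sigma> ^ i) + C * (\<epsilon> * (B * \<sigma> ^ (i - m)))"
      proof (intro add_mono mult_left_mono)
        show "a i \<le> B * \<sigma> ^ i" using less.IH[of i] i by simp
        show "M\<^sup>2 \<le> \<epsilon> * (B * \<sigma> ^ (i - m))"
          unfolding power2_eq_square using M0 \<open>0 \<le> \<epsilon>\<close> by (intro mult_mono) (auto simp: M_def)
      qed (use assms in auto)
      also have "\<dots> = B * (\<kappa> * \<sigma> ^ i + (C * \<epsilon>) * \<sigma> ^ (i - m))"
        by (simp add: algebra_simps)
      also have "\<dots> \<le> B * (\<kappa> * \<sigma> ^ i + (\<sigma>\<^sup>2 - \<kappa>) * \<sigma> ^ m * \<sigma> ^ (i - m))"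
        using B assms by (intro mult_left_mono add_left_mono mult_right_mono) auto
      also have "(\<sigma>\<^sup>2 - \<kappa>) * \<sigma> ^ m * \<sigma> ^ (i - m) = (\<sigma>\<^sup>2 - \<kappa>) * \<sigma> ^ i"
        using i \<open>m \<le> N\<close> by (simp add: mult.assoc flip: power_add)
      also have "B * (\<kappa> * \<sigma> ^ i + (\<sigma>\<^sup>2 - \<kappa>) * \<sigma> ^ i) = B * \<sigma> ^ k"
        by (simp add: i algebra_simps power_add power2_eq_square)
      finally show ?thesis .
    qed
  qed
  thus ?thesis using B by blast
qed

text \<open>The constant \<open>B\<close> disappears because \<open>root k B\<close> tends to 1, and
  \<sigma> may be taken arbitrarily close to \<gamma>.\<close>

lemma limsup_root_le:
  fixes a :: "nat \<Rightarrow> real"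
  assumes a: "\<And>k. 0 \<le> a k" and "0 \<le> \<gamma>" "\<gamma> < 1"
    and decay: "\<And>\<sigma>. \<lbrakk>\<gamma> < \<sigma>; \<sigma> < 1\<rbrakk> \<Longrightarrow> \<exists>B>0. \<forall>k. a k \<le> B * \<sigma> ^ k"
  shows "limsup (\<lambda>k. ereal (root k (a k))) \<le> ereal \<gamma>"
proof -
  have *: "limsup (\<lambda>k. ereal (root k (a k))) \<le> ereal \<sigma>" if \<sigma>: "\<gamma> < \<sigma>" "\<sigma> < 1" for \<sigma>
  proof -
    obtain B where B: "B > 0" "\<And>k. a k \<le> B * \<sigma> ^ k" using decay[OF \<sigma>] by auto
    have "(\<lambda>k. root k B * \<sigma>) \<longlonglongrightarrow> 1 * \<sigma>"
      using B by (intro tendsto_intros LIMSEQ_root_const)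
    hence "limsup (\<lambda>k. ereal (root k B * \<sigma>)) = ereal \<sigma>"
      by (intro lim_imp_Limsup) auto
    moreover have "\<forall>\<^sub>F k in sequentially. ereal (root k (a k)) \<le> ereal (root k B * \<sigma>)"
      using eventually_gt_at_top[of 0]
    proof eventually_elim
      case (elim k)
      have "root k (a k) \<le> root k (B * \<sigma> ^ k)" using elim B by simp
      also have "\<dots> = root k B * \<sigma>" using elim \<sigma> \<open>0 \<le> \<gamma>\<close> by (simp add: real_root_mult real_root_power_cancel)
      finally show ?case by simp
    qed
    ultimately show ?thesis using Limsup_mono by metis
  qed
  show ?thesis
  proof (rule dense_ge)
    fix y assume y: "ereal \<gamma> < y"
    have "ereal \<gamma> < min y 1" using y \<open>\<gamma> < 1\<close> by simp
    then obtain \<sigma> where "ereal \<gamma> < ereal \<sigma>" "ereal \<sigma> < min y 1"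
      by (metis ereal_dense2 )
    thus "limsup (\<lambda>k. ereal (root k (a k))) \<le> y" using *[of \<sigma>] by (auto intro: order_trans less_imp_le)
  qed
qed

subsection \<open>The iteration near the fixed point\<close>

text \<open>The plane geometry enters only through \<open>step\<close>, with \<omega> in the role of
  \<open>w0\<close>. The radius \<open>c\<close> is so small that the remainder uses up at most half
  of the gap \<open>1 - \<rho>\<close>, and \<open>C0\<close> admits both weights \<tau> and
  \<open>1 - \<tau>\<close> on a line through two residuals.\<close>

locale AA_contraction =
  fixes q W :: "'a::real_inner \<Rightarrow> 'a" and xs :: 'a
    and m :: nat and C0 C1 c \<rho> \<omega> :: real
  assumes m: "1 \<le> m" and W: "linear W"
    and \<rho>: "0 \<le> \<rho>" "\<rho> < 1" and norm_W: "\<And>y. norm (W y) \<le> \<rho> * norm y"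
    and c: "0 < c" and C1: "0 \<le> C1" and c_small: "C1 * c \<le> (1 - \<rho>) / 2"
    and expansion: "\<And>y. norm (y - xs) \<le> c \<Longrightarrow>
      norm (q y - (xs + W (y - xs))) \<le> C1 * (norm (y - xs))\<^sup>2"
    and C0: "1 + 1 / (1 - \<rho>) \<le> C0"
    and \<omega>: "0 \<le> \<omega>" "\<omega> \<le> 1"
    and step: "\<And>F v. 0 \<le> v \<bullet> (F - v) \<Longrightarrow>
      \<exists>\<tau>. \<bar>\<tau>\<bar> \<le> 1 / (1 - \<rho>) \<and> norm (F - \<tau> *\<^sub>R (F - W v)) \<le> \<omega> * norm F"
begin

text \<open>
  \<open>K\<close> bounds the growth of the error in one step, \<open>L\<close> the error in terms of the residual, and
  \<open>E\<close>, \<open>D\<close> are the constants of the quadratic remainders after one and two steps.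
\<close>

definition K where "K = 2 * real (m + 1) * C0"
definition E where "E = C1 * (K\<^sup>2 + real (m + 1) * C0)"
definition D where "D = E + \<rho> * E / (1 - \<rho>)"
definition L where "L = 2 / (1 - \<rho>)"

lemma C0_ge_2: "2 \<le> C0"
proof -
  have "1 \<le> 1 / (1 - \<rho>)" using \<rho> by simp
  thus ?thesis using C0 by linarith
qed

lemma K_ge_1: "1 \<le> K"
proof -
  have "1 * 1 \<le> real (m + 1) * C0" using C0_ge_2 by (intro mult_mono) auto
  thus ?thesis unfolding K_def by linarith
qed

lemma E_nonneg: "0 \<le> E"
  using C0_ge_2 C1 by (simp add: E_def)

lemma L_ge_2: "2 \<le> L"
  using \<rho> by (simp add: L_def field_simps)

lemma D_nonneg: "0 \<le> D"
  using E_nonneg \<rho> by (simp add: D_def)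

lemma card_window: "card (AA_window m k) \<le> m + 1"
  by (simp add: AA_window_def)

lemma sum_window_le:
  assumes "\<And>j. j \<in> AA_window m k \<Longrightarrow> \<bar>\<alpha> j\<bar> \<le> C0" "\<And>j. j \<in> AA_window m k \<Longrightarrow> norm (h j) \<le> b" "0 \<le> b"
  shows "norm (\<Sum>j\<in>AA_window m k. \<alpha> j *\<^sub>R h j) \<le> real (m + 1) * C0 * b"
proof -
  have "norm (\<Sum>j\<in>AA_window m k. \<alpha> j *\<^sub>R h j) \<le> (\<Sum>j\<in>AA_window m k. norm (\<alpha> j *\<^sub>R h j))"
    by (rule norm_sum)
  also have "\<dots> \<le> real (card (AA_window m k)) * (C0 * b)"
    by (rule sum_bounded_above) (use assms in \<open>force intro!: mult_mono\<close>)
  also have "\<dots> \<le> real (m + 1) * (C0 * b)"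
    using card_window[of k] C0_ge_2 assms(3) by (intro mult_right_mono) auto
  finally show ?thesis by (simp add: mult_ac)
qed

end

section \<open>Errors and residuals along one iteration\<close>

locale local_modified_AA = AA_contraction q W xs m C0 C1 c \<rho> \<omega>
  for q W :: "'a::real_inner \<Rightarrow> 'a" and xs :: 'a
    and m :: nat and C0 C1 c \<rho> \<omega> :: real +
  fixes x :: "nat \<Rightarrow> 'a"
  assumes AA: "modified_AA m C0 q x"
begin

definition e where "e j = x j - xs"
definition f where "f j = q (x j) - x j"
definition R where "R j = q (x j) - xs - W (e j)"

lemma f_eq: "f j = W (e j) - e j + R j"
  by (simp add: f_def R_def e_def)

lemma norm_R: "norm (e j) \<le> c \<Longrightarrow> norm (R j) \<le> C1 * (norm (e j))\<^sup>2"
  using expansion[of "x j"] by (simp add: e_def R_def diff_diff_eq)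

lemma norm_R':
  assumes "norm (e j) \<le> c" shows "norm (R j) \<le> (1 - \<rho>) / 2 * norm (e j)"
proof -
  have "norm (R j) \<le> (C1 * norm (e j)) * norm (e j)"
    using norm_R[OF assms] by (simp add: power2_eq_square mult_ac)
  also have "\<dots> \<le> (1 - \<rho>) / 2 * norm (e j)"
    using c_small mult_left_mono[OF assms C1] by (intro mult_right_mono) auto
  finally show ?thesis .
qed

text \<open>The identity minus \<open>W\<close> is bounded below by \<open>1 - \<rho>\<close>, and
  the remainder costs half of that. Estimates of residuals thus carry over to errors.\<close>

lemma norm_e_le:
  assumes "norm (e j) \<le> c" shows "norm (e j) \<le> L * norm (f j)"
proof -
  have "norm (e j) \<le> norm (W (e j)) + norm (R j) + norm (f j)"
    using norm_triangle_ineq4[of "W (e j) + R j" "f j"] norm_triangle_ineq[of "W (e j)" "R j"]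
    by (simp add: f_eq)
  also have "\<dots> \<le> \<rho> * norm (e j) + (1 - \<rho>) / 2 * norm (e j) + norm (f j)"
    using norm_W norm_R'[OF assms] by (intro add_mono) auto
  finally have "(1 - \<rho>) * norm (e j) \<le> 2 * norm (f j)" by (simp add: field_simps)
  thus ?thesis using \<rho> by (simp add: L_def field_simps)
qed

lemma norm_q_le:
  assumes "norm (e j) \<le> c" shows "norm (q (x j) - xs) \<le> 2 * norm (e j)"
proof -
  have "norm (q (x j) - xs) \<le> norm (W (e j)) + norm (R j)"
    using norm_triangle_ineq[of "W (e j)" "R j"] by (simp add: R_def)
  also have "\<dots> \<le> \<rho> * norm (e j) + (1 - \<rho>) / 2 * norm (e j)"
    using norm_W norm_R'[OF assms] by (intro add_mono) auto
  also have "\<dots> = (1 + \<rho>) / 2 * norm (e j)" by (simp add: field_simps)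
  also have "\<dots> \<le> 2 * norm (e j)" using \<rho> by (intro mult_right_mono) auto
  finally show ?thesis .
qed

lemma norm_f_le:
  assumes "norm (e j) \<le> c" shows "norm (f j) \<le> 3 * norm (e j)"
  using norm_triangle_ineq4[of "q (x j) - xs" "e j"] norm_q_le[OF assms]
  by (simp add: f_def e_def)

lemma coefficients:
  assumes "1 \<le> k"
  obtains \<alpha> where "(\<Sum>j\<in>AA_window m k. \<alpha> j) = 1" "\<And>j. j \<in> AA_window m k \<Longrightarrow> \<bar>\<alpha> j\<bar> \<le> C0"
    "\<And>\<beta>. AA_feasible m C0 k \<beta> \<Longrightarrow>
      norm (\<Sum>j\<in>AA_window m k. \<alpha> j *\<^sub>R f j) \<le> norm (\<Sum>j\<in>AA_window m k. \<beta> j *\<^sub>R f j)"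
    "e (k + 1) = (\<Sum>j\<in>AA_window m k. \<alpha> j *\<^sub>R (q (x j) - xs))"
proof -
  obtain \<alpha> where \<alpha>: "is_arg_min (\<lambda>\<alpha>. norm (\<Sum>j\<in>AA_window m k. \<alpha> j *\<^sub>R f j)) (AA_feasible m C0 k) \<alpha>"
    "x (k + 1) = (\<Sum>j\<in>AA_window m k. \<alpha> j *\<^sub>R q (x j))"
    using AA assms unfolding modified_AA_def f_def by blast
  have s: "(\<Sum>j\<in>AA_window m k. \<alpha> j) = 1"
    using \<alpha>(1) by (auto simp: is_arg_min_def AA_feasible_def)
  have "(\<Sum>j\<in>AA_window m k. \<alpha> j *\<^sub>R (q (x j) - xs)) = x (k + 1) - (\<Sum>j\<in>AA_window m k. \<alpha> j) *\<^sub>R xs"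
    unfolding \<alpha>(2) by (simp add: scaleR_diff_right sum_subtractf scaleR_sum_left)
  hence "e (k + 1) = (\<Sum>j\<in>AA_window m k. \<alpha> j *\<^sub>R (q (x j) - xs))" by (simp add: e_def s)
  note e1 = this
  show thesis
  proof (rule that[OF s _ _ e1])
    show "\<bar>\<alpha> j\<bar> \<le> C0" if "j \<in> AA_window m k" for j
      using \<alpha>(1) that by (auto simp: is_arg_min_def AA_feasible_def)
    show "norm (\<Sum>j\<in>AA_window m k. \<alpha> j *\<^sub>R f j) \<le> norm (\<Sum>j\<in>AA_window m k. \<beta> j *\<^sub>R f j)"
      if "AA_feasible m C0 k \<beta>" for \<beta>
      using \<alpha>(1) that by (auto simp: is_arg_min_def not_less)
  qed
qed

text \<open>
  The starting point \<open>x 0\<close> may be far from \<open>xs\<close>, but the mixed iterates involve it only through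
  \<open>q (x 0) = x 1\<close>.
\<close>

lemma growth:
  assumes k: "1 \<le> k" and M: "\<And>j. \<lbrakk>1 \<le> j; k - m \<le> j; j \<le> k\<rbrakk> \<Longrightarrow> norm (e j) \<le> M" "M \<le> c"
  shows "norm (e (k + 1)) \<le> K * M"
proof -
  have M0: "0 \<le> M" using order_trans[OF norm_ge_zero M(1)[of k]] k by simp
  have "norm (q (x j) - xs) \<le> 2 * M" if j: "j \<in> AA_window m k" for j
  proof (cases "j = 0")
    case True
    \<comment> \<open>A window containing 0 has \<open>k \<le> m\<close>, so the bound
      \<open>M\<close> is also available at index 1.\<close>
    hence "q (x j) - xs = e 1" "k \<le> m"
      using AA j by (auto simp: modified_AA_def e_def AA_window_def min_def split: if_splits)
    thus ?thesis using M(1)[of 1] k M0 by simp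
  next
    case False
    hence "norm (e j) \<le> M" using j by (intro M) (auto simp: AA_window_def)
    thus ?thesis using norm_q_le[of j] M(2) by linarith
  qed
  note q = this
  obtain \<alpha> where "\<And>j. j \<in> AA_window m k \<Longrightarrow> \<bar>\<alpha> j\<bar> \<le> C0"
    "e (k + 1) = (\<Sum>j\<in>AA_window m k. \<alpha> j *\<^sub>R (q (x j) - xs))"
    using coefficients[OF k] by metis
  thus ?thesis using sum_window_le[of k \<alpha> "\<lambda>j. q (x j) - xs" "2 * M"] q M0 by (simp add: K_def mult_ac)
qed

text \<open>As the coefficients sum to 1, \<open>v\<close> is \<open>e (k + 1)\<close> minus the
  mixed error, and \<open>W\<close> maps the mixed error to \<open>e (k + 1) - S\<close>. Hence
  \<open>f (k + 1) - W v = R (k + 1) - S\<close>, which is quadratic. The other claims test the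
  minimality of \<open>v\<close> against the segment to \<open>f k\<close> and the line through
  \<open>f (k - 1)\<close> and \<open>f k\<close>. The bound on \<open>k\<close> keeps index 0 out
  of the window.\<close>

lemma residual_step:
  assumes k: "m + 1 \<le> k" and M: "\<And>j. \<lbrakk>k - m \<le> j; j \<le> k\<rbrakk> \<Longrightarrow> norm (e j) \<le> M" "K * M \<le> c"
  obtains v where "0 \<le> v \<bullet> (f k - v)" "norm (f (k + 1) - W v) \<le> E * M\<^sup>2"
    "\<And>\<tau>. \<bar>\<tau>\<bar> \<le> 1 / (1 - \<rho>) \<Longrightarrow> norm v \<le> norm (f (k - 1) - \<tau> *\<^sub>R (f (k - 1) - f k))"
proof -
  let ?w = "AA_window m k"
  have w: "?w = {k - m..k}" using k by (simp add: AA_window_def min_def)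
  have kw: "k \<in> ?w" "k - 1 \<in> ?w" "k - 1 \<noteq> k" using m k by (auto simp: w)
  have fin: "finite ?w" by (simp add: w)
  have M0: "0 \<le> M" using order_trans[OF norm_ge_zero M(1)[of k]] by simp
  have "1 * M \<le> K * M" using K_ge_1 M0 by (intro mult_right_mono) auto
  hence Mc: "M \<le> c" using M(2) by simp
  obtain \<alpha> where \<alpha>: "(\<Sum>j\<in>?w. \<alpha> j) = 1" "\<And>j. j \<in> ?w \<Longrightarrow> \<bar>\<alpha> j\<bar> \<le> C0"
    "\<And>\<beta>. AA_feasible m C0 k \<beta> \<Longrightarrow> norm (\<Sum>j\<in>?w. \<alpha> j *\<^sub>R f j) \<le> norm (\<Sum>j\<in>?w. \<beta> j *\<^sub>R f j)"
    "e (k + 1) = (\<Sum>j\<in>?w. \<alpha> j *\<^sub>R (q (x j) - xs))"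
    by (rule coefficients[of k]) (use k in auto)
  define v where "v = (\<Sum>j\<in>?w. \<alpha> j *\<^sub>R f j)"
  define S where "S = (\<Sum>j\<in>?w. \<alpha> j *\<^sub>R R j)"
  have e1: "e (k + 1) = W (\<Sum>j\<in>?w. \<alpha> j *\<^sub>R e j) + S"
    unfolding \<alpha>(4) by (simp add: S_def linear_sum[OF W] linear_cmul[OF W] R_def flip: sum.distrib scaleR_add_right)
  have "v = W (\<Sum>j\<in>?w. \<alpha> j *\<^sub>R e j) - (\<Sum>j\<in>?w. \<alpha> j *\<^sub>R e j) + S"
    by (simp add: v_def S_def f_eq linear_sum[OF W] linear_cmul[OF W] scaleR_add_right scaleR_diff_right
        sum.distrib sum_subtractf)
  hence "v = e (k + 1) - (\<Sum>j\<in>?w. \<alpha> j *\<^sub>R e j)" unfolding e1 by simp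
  hence "W v = W (e (k + 1)) - (e (k + 1) - S)" unfolding e1 by (simp add: linear_diff[OF W])
  hence fW: "f (k + 1) - W v = R (k + 1) - S" by (simp add: f_eq)
  have eK: "norm (e (k + 1)) \<le> K * M" using k M Mc by (intro growth) auto
  have "norm (R (k + 1)) \<le> C1 * (K * M)\<^sup>2"
  proof -
    have "norm (R (k + 1)) \<le> C1 * (norm (e (k + 1)))\<^sup>2" using eK M(2) by (intro norm_R) auto
    also have "\<dots> \<le> C1 * (K * M)\<^sup>2" using eK C1 by (intro mult_left_mono power_mono) auto
    finally show ?thesis .
  qed
  moreover have "norm S \<le> real (m + 1) * C0 * (C1 * M\<^sup>2)"
    unfolding S_def
  proof (rule sum_window_le)
    fix j assume "j \<in> ?w"
    hence ej: "norm (e j) \<le> M" by (intro M) (auto simp: w)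
    hence "norm (R j) \<le> C1 * (norm (e j))\<^sup>2" using Mc by (intro norm_R) auto
    also have "\<dots> \<le> C1 * M\<^sup>2" using ej C1 by (intro mult_left_mono power_mono) auto
    finally show "norm (R j) \<le> C1 * M\<^sup>2" .
  qed (use \<alpha> C1 in auto)
  ultimately have "norm (f (k + 1) - W v) \<le> C1 * (K * M)\<^sup>2 + real (m + 1) * C0 * (C1 * M\<^sup>2)"
    unfolding fW using norm_triangle_ineq4[of "R (k + 1)" S] by linarith
  also have "\<dots> = E * M\<^sup>2" by (simp add: E_def power_mult_distrib algebra_simps)
  finally have 1: "norm (f (k + 1) - W v) \<le> E * M\<^sup>2" .
  have 2: "0 \<le> v \<bullet> (f k - v)"
  proof (rule ccontr)
    assume "\<not> 0 \<le> v \<bullet> (f k - v)"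
    hence neg: "v \<bullet> (f k - v) < 0" by simp
    define d where "d = f k - v"
    \<comment> \<open>Minimizes the norm on the ray from \<open>v\<close> towards
      \<open>f k\<close>, cut off at 1 so that \<beta> is a convex combination of \<alpha> and the
      unit weight at \<open>k\<close>, hence feasible.\<close>
    define t where "t = min 1 (- (v \<bullet> d) / (norm d)\<^sup>2)"
    have d0: "(norm d)\<^sup>2 > 0" using neg by (auto simp: d_def)
    have "0 < - (v \<bullet> d) / (norm d)\<^sup>2" using neg d0 by (intro divide_pos_pos) (auto simp: d_def)
    hence t: "0 < t" "t \<le> 1" by (auto simp: t_def)
    define \<beta> where "\<beta> j = (1 - t) * \<alpha> j + t * (if j = k then 1 else 0)" for j
    have "AA_feasible m C0 k \<beta>"
      unfolding AA_feasible_def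
    proof (intro conjI ballI)
      show "(\<Sum>j\<in>?w. \<beta> j) = 1"
        using kw fin \<alpha>(1) by (simp add: \<beta>_def sum.distrib flip: sum_distrib_left)
      fix j assume j: "j \<in> ?w"
      have "\<bar>\<beta> j\<bar> \<le> (1 - t) * \<bar>\<alpha> j\<bar> + t * \<bar>if j = k then 1 else 0\<bar>"
        unfolding \<beta>_def using t by (intro order_trans[OF abs_triangle_ineq]) (simp add: abs_mult)
      also have "\<dots> \<le> (1 - t) * C0 + t * C0"
        using t \<alpha>(2)[OF j] C0_ge_2 by (intro add_mono mult_left_mono) auto
      finally show "\<bar>\<beta> j\<bar> \<le> C0" by (simp add: algebra_simps)
    qed
    hence "norm v \<le> norm (\<Sum>j\<in>?w. \<beta> j *\<^sub>R f j)" unfolding v_def by (rule \<alpha>(3))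
    also have "(\<Sum>j\<in>?w. \<beta> j *\<^sub>R f j) = (1 - t) *\<^sub>R v + t *\<^sub>R (\<Sum>j\<in>?w. (if j = k then 1 else 0) *\<^sub>R f j)"
      by (simp add: \<beta>_def v_def scaleR_add_left sum.distrib scaleR_sum_right)
    also have "(\<Sum>j\<in>?w. (if j = k then 1 else 0) *\<^sub>R f j) = f k"
      using kw fin by (simp add: if_distrib[of "\<lambda>c. c *\<^sub>R _"] cong: if_cong)
    also have "(1 - t) *\<^sub>R v + t *\<^sub>R f k = v + t *\<^sub>R d" by (simp add: d_def algebra_simps)
    finally have "(norm v)\<^sup>2 \<le> (norm (v + t *\<^sub>R d))\<^sup>2" by (simp add: power_mono)
    also have "\<dots> = (norm v)\<^sup>2 + t * (2 * (v \<bullet> d) + t * (norm d)\<^sup>2)"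
      unfolding power2_norm_eq_inner by (simp add: inner_add inner_commute algebra_simps)
    finally have "0 \<le> 2 * (v \<bullet> d) + t * (norm d)\<^sup>2" using t by (simp add: zero_le_mult_iff)
    moreover have "t * (norm d)\<^sup>2 \<le> - (v \<bullet> d)" using d0 by (simp add: t_def min_le_iff_disj flip: pos_le_divide_eq)
    ultimately show False using neg by (simp add: d_def)
  qed
  have 3: "norm v \<le> norm (f (k - 1) - \<tau> *\<^sub>R (f (k - 1) - f k))" if \<tau>: "\<bar>\<tau>\<bar> \<le> 1 / (1 - \<rho>)" for \<tau>
  proof -
    \<comment> \<open>Index \<open>k - 1\<close> is in the window since \<open>m \<ge> 1\<close>;
      the lower bound on \<open>C0\<close> admits both weights.\<close>
    define \<beta> where "\<beta> j = (if j = k then \<tau> else 0) + (if j = k - 1 then 1 - \<tau> else 0)" for j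
    have "\<bar>\<tau>\<bar> \<le> C0" "\<bar>1 - \<tau>\<bar> \<le> C0" using \<tau> C0 by linarith+
    hence "AA_feasible m C0 k \<beta>"
      using kw fin C0_ge_2 by (auto simp: AA_feasible_def \<beta>_def sum.distrib)
    hence "norm v \<le> norm (\<Sum>j\<in>?w. \<beta> j *\<^sub>R f j)" unfolding v_def by (rule \<alpha>(3))
    also have "(\<Sum>j\<in>?w. \<beta> j *\<^sub>R f j) = \<tau> *\<^sub>R f k + (1 - \<tau>) *\<^sub>R f (k - 1)"
      using kw fin by (simp add: \<beta>_def scaleR_add_left sum.distrib if_distrib[of "\<lambda>c. c *\<^sub>R _"] cong: if_cong)
    also have "\<dots> = f (k - 1) - \<tau> *\<^sub>R (f (k - 1) - f k)" by (simp add: algebra_simps)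
    finally show ?thesis .
  qed
  show thesis by (rule that[OF 2 1 3])
qed

text \<open>As \<open>f (k + 1)\<close> is nearly \<open>W v\<close>, the line through
  \<open>f k\<close> and \<open>f (k + 1)\<close> is nearly the one in \<open>step\<close>, and
  \<open>v'\<close> is no longer than the relevant point on it. This gives \<omega>; the factor
  \<rho> comes from \<open>f (k + 2)\<close> being nearly \<open>W v'\<close>. In \<open>D\<close>,
  the summand \<open>\<rho> * E / (1 - \<rho>)\<close> is the price of replacing
  \<open>f (k + 1)\<close> by \<open>W v\<close>.\<close>

lemma two_step:
  assumes k: "m + 1 \<le> k" and M: "\<And>j. \<lbrakk>k - m \<le> j; j \<le> k + 1\<rbrakk> \<Longrightarrow> norm (e j) \<le> M" "K * M \<le> c"
  shows "norm (f (k + 2)) \<le> \<omega> * \<rho> * norm (f k) + D * M\<^sup>2"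
proof -
  obtain v where v: "0 \<le> v \<bullet> (f k - v)" "norm (f (k + 1) - W v) \<le> E * M\<^sup>2"
    by (rule residual_step[OF k _ M(2)]) (use M(1) in auto)
  obtain v' where v': "norm (f (k + 2) - W v') \<le> E * M\<^sup>2"
    "\<And>\<tau>. \<bar>\<tau>\<bar> \<le> 1 / (1 - \<rho>) \<Longrightarrow> norm v' \<le> norm (f k - \<tau> *\<^sub>R (f k - f (k + 1)))"
    by (rule residual_step[of "k + 1" M]) (use k M in auto)
  obtain \<tau> where \<tau>: "\<bar>\<tau>\<bar> \<le> 1 / (1 - \<rho>)" "norm (f k - \<tau> *\<^sub>R (f k - W v)) \<le> \<omega> * norm (f k)"
    using step[OF v(1)] by blast
  have "f k - \<tau> *\<^sub>R (f k - f (k + 1)) = (f k - \<tau> *\<^sub>R (f k - W v)) + \<tau> *\<^sub>R (f (k + 1) - W v)"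
    by (simp add: algebra_simps)
  hence "norm v' \<le> norm (f k - \<tau> *\<^sub>R (f k - W v)) + \<bar>\<tau>\<bar> * norm (f (k + 1) - W v)"
    using v'(2)[OF \<tau>(1)] by (metis norm_scaleR norm_triangle_ineq order_trans)
  also have "\<dots> \<le> \<omega> * norm (f k) + 1 / (1 - \<rho>) * (E * M\<^sup>2)"
    using \<tau> v(2) \<rho> by (intro add_mono mult_mono) auto
  finally have "\<rho> * norm v' \<le> \<rho> * (\<omega> * norm (f k) + 1 / (1 - \<rho>) * (E * M\<^sup>2))"
    using \<rho> by (intro mult_left_mono) auto
  moreover have "norm (f (k + 2)) \<le> norm (W v') + norm (f (k + 2) - W v')"
    using norm_triangle_ineq[of "W v'" "f (k + 2) - W v'"] by simp
  ultimately have "norm (f (k + 2)) \<le> \<rho> * (\<omega> * norm (f k) + 1 / (1 - \<rho>) * (E * M\<^sup>2)) + E * M\<^sup>2"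
    using v'(1) norm_W[of v'] by linarith
  thus ?thesis by (simp add: D_def algebra_simps)
qed

section \<open>Confinement to a neighborhood and geometric decay\<close>

text \<open>The two-step estimate first reaches index \<open>m + 3\<close>; up to
  \<open>m + 2\<close> there is only growth by a factor \<open>K\<close> per step, which closeness
  of \<open>x 1\<close> has to compensate.\<close>

lemma initial_growth:
  assumes "1 \<le> k" "k \<le> m + 2" "K ^ (m + 1) * norm (e 1) \<le> c"
  shows "norm (e k) \<le> K ^ (k - 1) * norm (e 1)"
  using assms(1,2)
proof (induction k rule: less_induct)
  case (less k)
  show ?case
  proof (cases "k = 1")
    case False
    define i where "i = k - 1"
    have i: "k = i + 1" "1 \<le> i" using False less.prems by (auto simp: i_def)
    have "norm (e (i + 1)) \<le> K * (K ^ (i - 1) * norm (e 1))"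
    proof (rule growth[OF i(2)])
      fix j assume j: "1 \<le> j" "j \<le> i"
      have "norm (e j) \<le> K ^ (j - 1) * norm (e 1)" using j i less by auto
      also have "\<dots> \<le> K ^ (i - 1) * norm (e 1)"
        using j K_ge_1 by (intro mult_right_mono power_increasing) auto
      finally show "norm (e j) \<le> K ^ (i - 1) * norm (e 1)" .
    next
      have "K ^ (i - 1) * norm (e 1) \<le> K ^ (m + 1) * norm (e 1)"
        using i less.prems K_ge_1 by (intro mult_right_mono power_increasing) auto
      thus "K ^ (i - 1) * norm (e 1) \<le> c" using assms(3) by simp
    qed
    also have "K * (K ^ (i - 1) * norm (e 1)) = K ^ (k - 1) * norm (e 1)"
      using i by (cases i) auto
    finally show ?thesis using i by simp
  qed auto
qed

text \<open>Joint induction: the two-step estimate keeps the residual below \<open>A\<close>, and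
  \<open>norm_e_le\<close> then bounds the error, provided the iterate is in the ball of radius
  \<open>c\<close>.\<close>

lemma stays_small:
  assumes A: "0 < A" "K * (L * A) \<le> c" "D * L\<^sup>2 * A \<le> 1 - \<omega> * \<rho>"
    and e1: "3 * K ^ (m + 1) * norm (e 1) \<le> A"
    and "1 \<le> k"
  shows "norm (e k) \<le> L * A \<and> norm (f k) \<le> A"
  using \<open>1 \<le> k\<close>
proof (induction k rule: less_induct)
  case (less k)
  have LA: "A \<le> L * A" "L * A \<le> K * (L * A)" 
    using A(1) L_ge_2 K_ge_1 mult_right_mono[of 1 L A] mult_right_mono[of 1 K "L * A"] by auto
  show ?case
  proof (cases "k \<le> m + 2")
    case True
    have "0 \<le> K ^ (m + 1) * norm (e 1)" using K_ge_1 by simp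
    hence "K ^ (m + 1) * norm (e 1) \<le> c" using e1 A LA by linarith
    hence "norm (e k) \<le> K ^ (k - 1) * norm (e 1)"
      using True less.prems by (intro initial_growth) auto
    also have "\<dots> \<le> K ^ (m + 1) * norm (e 1)"
      using True K_ge_1 by (intro mult_right_mono power_increasing) auto
    finally have *: "3 * norm (e k) \<le> A" using e1 by simp
    hence "norm (e k) \<le> c" using A LA norm_ge_zero[of "e k"] by linarith
    hence "norm (f k) \<le> 3 * norm (e k)" by (rule norm_f_le)
    thus ?thesis using * A LA norm_ge_zero[of "e k"] by linarith
  next
    case False
    define i where "i = k - 2"
    have i: "k = i + 2" "m + 1 \<le> i" using False by (auto simp: i_def)
    have IH: "norm (e j) \<le> L * A" "norm (f j) \<le> A" if "i - m \<le> j" "j \<le> i + 1" for j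
      using less.IH[of j] that i by auto
    have "norm (f (i + 2)) \<le> \<omega> * \<rho> * norm (f i) + D * (L * A)\<^sup>2"
      using i A IH by (intro two_step) auto
    also have "\<dots> \<le> \<omega> * \<rho> * A + (D * L\<^sup>2 * A) * A"
      using IH(2)[of i] \<rho> \<omega> by (intro add_mono mult_left_mono) (auto simp: power2_eq_square)
    also have "\<dots> \<le> \<omega> * \<rho> * A + (1 - \<omega> * \<rho>) * A"
      using A by (intro add_left_mono mult_right_mono) auto
    finally have f: "norm (f k) \<le> A" by (simp add: i algebra_simps)
    have "L * A \<le> c" using A LA by linarith
    \<comment> \<open>A crude bound that only places the iterate in the ball; the residual then
      improves it.\<close>
    hence "norm (e (i + 1 + 1)) \<le> K * (L * A)"
      using i IH by (intro growth) auto
    hence "norm (e k) \<le> L * norm (f k)" using A i by (intro norm_e_le) auto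
    also have "\<dots> \<le> L * A" using f L_ge_2 by (intro mult_left_mono) auto
    finally show ?thesis using f by simp
  qed
qed

text \<open>The scalar recursion is used twice. With the fixed rate \<open>\<sigma>0\<close> and
  threshold \<open>A\<close> it shows that the residuals tend to 0, so for each admissible \<sigma>
  they finally fall below the threshold that \<sigma> demands. The condition on \<open>x 1\<close>
  is thus independent of \<sigma>.\<close>

lemma geometric_decay:
  assumes A: "0 < A" "K * (L * A) \<le> c" "D * L\<^sup>2 * A \<le> (\<sigma>0\<^sup>2 - \<omega> * \<rho>) * \<sigma>0 ^ m"
    and \<sigma>0: "0 < \<sigma>0" "\<sigma>0 < 1" "\<omega> * \<rho> < \<sigma>0\<^sup>2"
    and e1: "3 * K ^ (m + 1) * norm (e 1) \<le> A"
    and \<sigma>: "sqrt (\<omega> * \<rho>) < \<sigma>" "\<sigma> < 1"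
  shows "\<exists>B>0. \<forall>k. norm (e k) \<le> B * \<sigma> ^ k"
proof -
  let ?\<kappa> = "\<omega> * \<rho>" and ?C = "D * L\<^sup>2" and ?a = "\<lambda>k. norm (f k)"
  have \<kappa>: "0 \<le> ?\<kappa>" using \<omega> \<rho> by simp
  have C: "0 \<le> ?C" using D_nonneg by simp
  have \<sigma>02: "\<sigma>0\<^sup>2 \<le> 1" "?\<kappa> \<le> 1" using \<sigma>0 power_le_one[of \<sigma>0 2] by linarith+
  have "(\<sigma>0\<^sup>2 - ?\<kappa>) * \<sigma>0 ^ m \<le> (1 - ?\<kappa>) * 1"
    using \<sigma>0 \<kappa> \<sigma>02 by (intro mult_mono) (auto simp: power_le_one)
  hence small: "norm (e k) \<le> L * A" "?a k \<le> A" if "1 \<le> k" for k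
    using stays_small[OF A(1,2) _ e1 that] A(3) by auto
  have LA: "L * A \<le> c"
  proof -
    have "0 \<le> L * A" using A L_ge_2 by simp
    thus ?thesis using A K_ge_1 mult_right_mono[of 1 K "L * A"] by simp
  qed
  have rec: "?a (k + 2) \<le> ?\<kappa> * ?a k + ?C * M\<^sup>2"
    if k: "m + 1 \<le> k" and M: "0 \<le> M" "\<And>j. \<lbrakk>k - m \<le> j; j \<le> k + 1\<rbrakk> \<Longrightarrow> ?a j \<le> M" for k M
  proof -
    \<comment> \<open>The recursion is stated for every \<open>M\<close>, the two-step estimate only
      for small errors; hence the truncation at \<open>A\<close>.\<close>
    define M' where "M' = min M A"
    have M': "0 \<le> M'" "M' \<le> A" "M' \<le> M" using M A by (auto simp: M'_def)
    have "?a (k + 2) \<le> ?\<kappa> * ?a k + D * (L * M')\<^sup>2"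
    proof (rule two_step[OF k])
      fix j assume j: "k - m \<le> j" "j \<le> k + 1"
      hence "1 \<le> j" using k by linarith
      note s = small[OF this]
      have "norm (e j) \<le> L * ?a j" using s LA by (intro norm_e_le) auto
      also have "\<dots> \<le> L * M'"
        using s M(2)[OF j] L_ge_2 by (intro mult_left_mono) (auto simp: M'_def)
      finally show "norm (e j) \<le> L * M'" .
    next
      have "K * (L * M') \<le> K * (L * A)" using K_ge_1 L_ge_2 M' by (intro mult_left_mono) auto
      thus "K * (L * M') \<le> c" using A by simp
    qed
    also have "D * (L * M')\<^sup>2 = ?C * M'\<^sup>2" by (simp add: power_mult_distrib)
    also have "?\<kappa> * ?a k + ?C * M'\<^sup>2 \<le> ?\<kappa> * ?a k + ?C * M\<^sup>2"
      using C M' by (intro add_left_mono mult_left_mono power_mono) auto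
    finally show ?thesis .
  qed
  \<comment> \<open>Starting at \<open>m + 1\<close>, smallness is required from index 1 on;
    \<open>x 0\<close> may be far away.\<close>
  obtain B0 where B0: "B0 > 0" "\<And>k. ?a k \<le> B0 * \<sigma>0 ^ k"
    using geometric_decay_of_recursion[of "m + 1" m ?a ?\<kappa> ?C A \<sigma>0] rec small A \<sigma>0 \<kappa> C by auto
  have "(\<lambda>k. B0 * \<sigma>0 ^ k) \<longlonglongrightarrow> B0 * 0"
    using \<sigma>0 by (intro tendsto_mult tendsto_const LIMSEQ_realpow_zero) auto
  hence lim: "?a \<longlonglongrightarrow> 0"
    using B0 by (intro tendsto_sandwich[of "\<lambda>_. 0" ?a _ "\<lambda>k. B0 * \<sigma>0 ^ k"]) auto
  have \<sigma>': "0 < \<sigma>" "?\<kappa> < \<sigma>\<^sup>2"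
  proof -
    have "0 \<le> sqrt ?\<kappa>" using \<kappa> by simp
    thus "0 < \<sigma>" using \<sigma>(1) by linarith
    have "(sqrt ?\<kappa>)\<^sup>2 < \<sigma>\<^sup>2" by (rule power_strict_mono[OF \<sigma>(1)]) (use \<kappa> in auto)
    thus "?\<kappa> < \<sigma>\<^sup>2" using \<kappa> by simp
  qed
  define \<epsilon> where "\<epsilon> = (\<sigma>\<^sup>2 - ?\<kappa>) * \<sigma> ^ m / (?C + 1)"
  have \<epsilon>: "0 < \<epsilon>" using \<sigma>' C by (simp add: \<epsilon>_def add_nonneg_pos)
  have "?C * \<epsilon> \<le> (?C + 1) * \<epsilon>" using \<epsilon> by simp
  also have "\<dots> = (\<sigma>\<^sup>2 - ?\<kappa>) * \<sigma> ^ m" using C by (simp add: \<epsilon>_def)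
  finally have C\<epsilon>: "?C * \<epsilon> \<le> (\<sigma>\<^sup>2 - ?\<kappa>) * \<sigma> ^ m" .
  obtain N where N: "\<And>k. N \<le> k \<Longrightarrow> ?a k \<le> \<epsilon>"
    using order_tendstoD(2)[OF lim \<epsilon>] unfolding eventually_sequentially by (meson less_imp_le)
  \<comment> \<open>The offset \<open>m + 1\<close> puts all windows beyond \<open>N\<close> and
    makes \<open>rec\<close> applicable.\<close>
  obtain B where B: "B > 0" "\<And>k. ?a k \<le> B * \<sigma> ^ k"
    using geometric_decay_of_recursion[of "N + m + 1" m ?a ?\<kappa> ?C \<epsilon> \<sigma>] rec N \<epsilon> C\<epsilon> \<sigma> \<sigma>' \<kappa> C by auto
  \<comment> \<open>The term \<open>norm (e 0)\<close> covers index 0, where residuals do not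
    control the error.\<close>
  have "norm (e k) \<le> (L * B + norm (e 0)) * \<sigma> ^ k" for k
  proof (cases "k = 0")
    case False
    hence "norm (e k) \<le> L * ?a k" using small[of k] LA by (intro norm_e_le) auto
    also have "\<dots> \<le> L * (B * \<sigma> ^ k)" using B L_ge_2 by (intro mult_left_mono) auto
    also have "\<dots> \<le> (L * B + norm (e 0)) * \<sigma> ^ k" using \<sigma>' by (simp add: algebra_simps)
    finally show ?thesis .
  qed (use B L_ge_2 in auto)
  moreover have "L * B + norm (e 0) > 0" using B L_ge_2 by (simp add: add_pos_nonneg)
  ultimately show ?thesis by blast
qed

end

lemma (in AA_contraction) local_geometric_decay:
  "\<exists>r>0. \<forall>x. modified_AA m C0 q x \<longrightarrow> norm (x 1 - xs) < r \<longrightarrow>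
    (\<forall>\<sigma>. sqrt (\<omega> * \<rho>) < \<sigma> \<longrightarrow> \<sigma> < 1 \<longrightarrow> (\<exists>B>0. \<forall>k. norm (x k - xs) \<le> B * \<sigma> ^ k))"
proof -
  have "\<omega> * \<rho> \<le> \<rho>" "0 \<le> \<omega> * \<rho>" using \<omega> \<rho> by (simp_all add: mult_left_le_one_le)
  hence \<kappa>: "0 \<le> \<omega> * \<rho>" "\<omega> * \<rho> < 1" using \<rho> by auto
  \<comment> \<open>A rate strictly between \<open>sqrt (\<omega> * \<rho>)\<close> and 1, fixed
    before the iteration and \<sigma>.\<close>
  define \<sigma>0 where "\<sigma>0 = sqrt ((1 + \<omega> * \<rho>) / 2)"
  have \<sigma>0: "0 < \<sigma>0" "\<sigma>0 < 1" "\<omega> * \<rho> < \<sigma>0\<^sup>2" using \<kappa> by (simp_all add: \<sigma>0_def)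
  define d where "d = (\<sigma>0\<^sup>2 - \<omega> * \<rho>) * \<sigma>0 ^ m"
  have d: "0 < d" using \<sigma>0 by (simp add: d_def)
  \<comment> \<open>Both smallness conditions of \<open>geometric_decay\<close> solved for
    \<open>A\<close>; the summand 1 avoids division by 0.\<close>
  define A where "A = min (c / (K * L)) (d / (D * L\<^sup>2 + 1))"
  have KL: "0 < K" "0 < L" using K_ge_1 L_ge_2 by auto
  have DL: "0 \<le> D * L\<^sup>2" "0 < D * L\<^sup>2 + 1" using D_nonneg by (auto intro: add_nonneg_pos)
  have A: "0 < A" using KL DL c d by (simp add: A_def)
  have "A * (K * L) \<le> c"
    using KL by (simp add: A_def min_le_iff_disj flip: pos_le_divide_eq)
  hence A1: "K * (L * A) \<le> c" by (simp add: mult_ac)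
  have "A * (D * L\<^sup>2 + 1) \<le> d"
    using DL by (simp add: A_def min_le_iff_disj flip: pos_le_divide_eq)
  hence A2: "D * L\<^sup>2 * A \<le> d" using A by (simp add: algebra_simps)
  show ?thesis
  proof (rule exI[of _ "A / (3 * K ^ (m + 1))"], intro conjI allI impI)
    show "0 < A / (3 * K ^ (m + 1))" using A KL by simp
    fix x \<sigma>
    assume x: "modified_AA m C0 q x" "norm (x 1 - xs) < A / (3 * K ^ (m + 1))"
      and \<sigma>: "sqrt (\<omega> * \<rho>) < \<sigma>" "\<sigma> < 1"
    interpret local_modified_AA q W xs m C0 C1 c \<rho> \<omega> x
      by unfold_locales (rule x(1))
    have "3 * K ^ (m + 1) * norm (e 1) \<le> A"
      using x(2) KL by (simp add: e_def field_simps)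
    thus "\<exists>B>0. \<forall>k. norm (x k - xs) \<le> B * \<sigma> ^ k"
      using geometric_decay[OF A A1 A2[unfolded d_def] \<sigma>0 _ \<sigma>] by (simp add: e_def)
  qed
qed

section \<open>The supremum \<open>w0\<close> and the final assembly\<close>

lemma w0_eq:
  fixes W :: "real^'n^'n"
  assumes "lambda_min W \<le> lambda_max W"
  shows "w0 W = (SUP \<delta>\<in>{0..}. sin (aa_angle ((lambda_max W + lambda_min W) / 2)
    ((lambda_max W - lambda_min W) / 2) \<delta>))"
  unfolding w0_def
proof (rule SUP_cong[OF refl])
  fix \<delta> :: real
  let ?l = "lambda_max W" and ?m = "lambda_min W"
  have "4 + (2 - ?l - ?m)\<^sup>2 * \<delta>\<^sup>2 = 2\<^sup>2 * (1 + (1 - (?l + ?m) / 2)\<^sup>2 * \<delta>\<^sup>2)"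
    by (simp add: power2_eq_square field_simps)
  hence "sqrt (4 + (2 - ?l - ?m)\<^sup>2 * \<delta>\<^sup>2) = 2 * sqrt (1 + (1 - (?l + ?m) / 2)\<^sup>2 * \<delta>\<^sup>2)"
    by (simp only: real_sqrt_mult real_sqrt_abs abs_numeral)
  thus "sin (arcsin (\<bar>?l - ?m\<bar> * \<delta> / sqrt (4 + (2 - ?l - ?m)\<^sup>2 * \<delta>\<^sup>2))
      + \<bar>arctan \<delta> - arctan ((1 - (?l + ?m) / 2) * \<delta>)\<bar>) =
    sin (aa_angle ((?l + ?m) / 2) ((?l - ?m) / 2) \<delta>)"
    using assms by (simp add: aa_angle_def)
qed

theorem theorem6:
  fixes q g :: "real^'n \<Rightarrow> real^'n"
    and W :: "real^'n^'n"
    and xs y0 z0 :: "real^'n"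
    and m :: nat and c1 C1 :: real
  assumes "m \<ge> 1"
    and "q xs = xs"
    and "(q has_derivative ((*v) W)) (at xs)"
    and "transpose W = W"
    and "spectral_norm W < 1"
    and "c1 > 0" and "C1 > 0"
    and "\<And>x. norm (x - xs) \<le> c1 \<Longrightarrow>
           norm (q x - (xs + W *v (x - xs))) \<le> C1 * (norm (x - xs))\<^sup>2"
    and "\<And>x1 x2. norm (x1 - xs) \<le> c1 \<Longrightarrow> norm (x2 - xs) \<le> c1 \<Longrightarrow>
           norm (q x1 - q x2) \<le> C1 * norm (x1 - x2)"
    and "inverse_expansion_point xs y0 z0"
    and "is_local_inverse (\<lambda>x. q x - x) g y0 c1"
    and "\<And>y. norm (y - y0) \<le> c1 \<Longrightarrow>
           norm (g y - (z0 + matrix_inv (W - mat 1) *v (y - y0))) \<le> C1 * (norm (y - y0))\<^sup>2"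
    and "\<And>y1 y2. norm (y1 - y0) \<le> c1 \<Longrightarrow> norm (y2 - y0) \<le> c1 \<Longrightarrow>
           norm (g y1 - g y2) \<le> C1 * norm (y1 - y2)"
  shows "\<exists>C0'>0. \<forall>C0>C0'. \<exists>c0'>0. \<forall>x.
           modified_AA m C0 q x \<longrightarrow> norm (x 1 - xs) < c0' \<longrightarrow>
             x \<longlonglongrightarrow> xs \<and>
             r_linear_factor x xs \<le> ereal (sqrt (w0 W * spectral_norm W))"
proof -
  define \<rho> where "\<rho> = spectral_norm W"
  define \<omega> where "\<omega> = w0 W"
  define s where "s = (lambda_max W + lambda_min W) / 2"
  define r where "r = (lambda_max W - lambda_min W) / 2"
  define c where "c = min c1 ((1 - \<rho>) / (2 * C1))"
  note sp = symmetric_spectrum[OF \<open>transpose W = W\<close>]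
  have norm_W: "norm (W *v y) \<le> \<rho> * norm y" for y
    unfolding \<rho>_def spectral_norm_def by (rule onorm[OF matrix_vector_mul_bounded_linear])
  have \<rho>: "0 \<le> \<rho>" "\<rho> < 1"
    using assms(5) by (auto simp: \<rho>_def spectral_norm_def onorm_pos_le matrix_vector_mul_bounded_linear)
  have "\<bar>lambda_max W\<bar> < 1" "\<bar>lambda_min W\<bar> < 1"
    using sp(1,2)[THEN eigenvalue_le_spectral_norm] \<rho>(2) by (auto simp: \<rho>_def)
  \<comment> \<open>The last inequality amounts to \<open>lambda_max W < 1\<close>, as
    \<open>r + s = lambda_max W\<close>.\<close>
  hence r: "0 \<le> r" "r < 1" "r < 1 - s"
    using sp(3) by (auto simp: r_def s_def abs_less_iff field_simps)
  have bdd: "bdd_above ((\<lambda>\<delta>. sin (aa_angle s r \<delta>)) ` {0..})"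
    by (rule bdd_aboveI2[of _ _ 1]) simp
  have \<omega>_eq: "\<omega> = (SUP \<delta>\<in>{0..}. sin (aa_angle s r \<delta>))"
    unfolding \<omega>_def s_def r_def by (rule w0_eq[OF sp(3)])
  have angle: "sin (aa_angle s r \<delta>) \<le> \<omega>" if "0 \<le> \<delta>" for \<delta>
    unfolding \<omega>_eq by (rule cSUP_upper[OF _ bdd]) (use that in simp)
  have \<omega>: "0 \<le> \<omega>" "\<omega> \<le> 1"
    using angle[of 0] by (simp_all add: aa_angle_def) (auto simp: \<omega>_eq intro!: cSUP_least)
  have step: "\<exists>\<tau>. \<bar>\<tau>\<bar> \<le> 1 / (1 - \<rho>) \<and> norm (F - \<tau> *\<^sub>R (F - W *v v)) \<le> \<omega> * norm F"
    if "0 \<le> v \<bullet> (F - v)" for F v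
    by (rule exists_step_residual_le[OF matrix_vector_mul_linear r _ \<rho>(2) norm_W \<rho>(1) that angle])
       (use sp(4) in \<open>simp add: s_def r_def\<close>)
  have "\<omega> * \<rho> \<le> \<rho>" using \<omega> \<rho> by (simp add: mult_left_le_one_le)
  hence \<gamma>: "0 \<le> sqrt (\<omega> * \<rho>)" "sqrt (\<omega> * \<rho>) < 1" using \<omega> \<rho> by auto
  show ?thesis
  \<comment> \<open>This bounds the weight \<open>1 - \<tau>\<close> in the competing combination,
    given the bound on \<tau> in \<open>step\<close>.\<close>
  proof (rule exI[of _ "1 + 1 / (1 - \<rho>)"], intro conjI allI impI)
    show "0 < 1 + 1 / (1 - \<rho>)" using \<rho> by (simp add: add_pos_pos)
    fix C0 :: real assume C0: "1 + 1 / (1 - \<rho>) < C0"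
    interpret AA_contraction q "(*v) W" xs m C0 C1 c \<rho> \<omega>
    proof (rule AA_contraction.intro)
      show "C1 * c \<le> (1 - \<rho>) / 2"
      proof -
        have "C1 * c \<le> C1 * ((1 - \<rho>) / (2 * C1))"
          using \<open>C1 > 0\<close> by (intro mult_left_mono) (auto simp: c_def)
        thus ?thesis using \<open>C1 > 0\<close> by simp
      qed
      show "norm (q y - (xs + W *v (y - xs))) \<le> C1 * (norm (y - xs))\<^sup>2" if "norm (y - xs) \<le> c" for y
        using assms(8) that by (simp add: c_def)
      show "linear ((*v) W)" by (rule matrix_vector_mul_linear)
    qed (use assms(1,6,7) \<rho> \<omega> C0 norm_W step in \<open>auto simp: c_def\<close>)
    obtain d where d: "d > 0" "\<And>x \<sigma>. \<lbrakk>modified_AA m C0 q x; norm (x 1 - xs) < d; sqrt (\<omega> * \<rho>) < \<sigma>; \<sigma> < 1\<rbrakk>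
        \<Longrightarrow> \<exists>B>0. \<forall>k. norm (x k - xs) \<le> B * \<sigma> ^ k"
      using local_geometric_decay by metis
    show "\<exists>c0'>0. \<forall>x. modified_AA m C0 q x \<longrightarrow> norm (x 1 - xs) < c0' \<longrightarrow>
        x \<longlonglongrightarrow> xs \<and> r_linear_factor x xs \<le> ereal (sqrt (w0 W * spectral_norm W))"
    proof (rule exI[of _ d], intro conjI allI impI)
      fix x assume x: "modified_AA m C0 q x" "norm (x 1 - xs) < d"
      \<comment> \<open>A single rate below 1 suffices for convergence; the r-linear factor uses all
        rates above \<open>sqrt (\<omega> * \<rho>)\<close>.\<close>
      obtain \<sigma> where \<sigma>: "sqrt (\<omega> * \<rho>) < \<sigma>" "\<sigma> < 1" using dense[OF \<gamma>(2)] by blast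
      obtain B where B: "\<And>k. norm (x k - xs) \<le> B * \<sigma> ^ k" using d(2)[OF x \<sigma>] by blast
      have "0 \<le> \<sigma>" using \<sigma> \<gamma> by linarith
      hence "(\<lambda>k. B * \<sigma> ^ k) \<longlonglongrightarrow> B * 0"
        using \<sigma> by (intro tendsto_mult tendsto_const LIMSEQ_realpow_zero) auto
      hence "(\<lambda>k. x k - xs) \<longlonglongrightarrow> 0"
        by (intro Lim_null_comparison[OF always_eventually[OF allI[OF B]]]) simp
      thus "x \<longlonglongrightarrow> xs" by (simp add: LIM_zero_iff)
      show "r_linear_factor x xs \<le> ereal (sqrt (w0 W * spectral_norm W))"
        unfolding r_linear_factor_def \<rho>_def[symmetric] \<omega>_def[symmetric]
      proof (rule limsup_root_le[OF norm_ge_zero \<gamma>])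
        show "\<exists>B>0. \<forall>k. norm (xs - x k) \<le> B * \<sigma> ^ k" if "sqrt (\<omega> * \<rho>) < \<sigma>" "\<sigma> < 1" for \<sigma>
          using d(2)[OF x that] by (simp only: norm_minus_commute)
      qed
    qed (rule d(1))
  qed
qed

end
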